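(* Consider the time-delay system $\dot x(t)=f(t,x_t,u(t))$ with $f:\mathbb R_{\ge0}\times\mathcal C\times\mathbb R^m\to\mathbb R^n$, under the standing assumptions in the context, and suppose that: (R1) there exist $\gamma\in\mathcal K_\infty$ and a non-decreasing $N:\mathbb R_{\ge0}\to\mathbb R_{>0}$ such that $|f(t,\psi,\mu)|\le N(\|\psi\|)(1+\gamma(|\mu|))$ for all $t\ge0$, $\psi\in\mathcal C$, $\mu\in\mathbb R^m$; (R2) for every $r>0$ and $\varepsilon>0$ there exists $\delta>0$ such that for all $t\ge0$, $|f(t,\psi,\mu)-f(t,\psi,0)|<\varepsilon$ whenever $\|\psi\|\le r$ and $|\mu|\le\delta$; (R3) for all $r>0$ there exists $L=L(r)$ such that $|f(t,\psi,0)-f(t,\varphi,0)|\le L\|\psi-\varphi\|$ for all $t\ge0$ whenever $\|\psi\|\le r$ and $\|\varphi\|\le r$. Let $\gamma\in\mathcal K_\infty$ be the function given by (R1). Then: a) If the system is iISS with gain $\kappa$, then it is 0-GUAS and UBEBS with gain $\kappa$. b) If the system is 0-GUAS and UBEBS with gain $\alpha$, then it is iISS with gain $\kappa=\max\{\alpha,\gamma\}$.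
   Context: Comparison functions. $\alpha\in\mathcal K$ if $\alpha:\mathbb R_{\ge0}\to\mathbb R_{\ge0}$ is continuous, strictly increasing, $\alpha(0)=0$; $\alpha\in\mathcal K_\infty$ if moreover unbounded. $\beta\in\mathcal{KL}$ if $\beta:\mathbb R_{\ge0}\times\mathbb R_{\ge0}\to\mathbb R_{\ge0}$, $\beta(\cdot,t)\in\mathcal K$ for each $t\ge0$, and for each fixed $r\ge0$, $\beta(r,t)$ decreases monotonically to $0$ as $t\to\infty$. Time-delay system. Fix $\tau\ge0$; $\mathcal C=\mathcal C([-\tau,0],\mathbb R^n)$ is the space of continuous functions with the supremum norm $\|\psi\|=\sup_{s\in[-\tau,0]}|\psi(s)|$ ($|\cdot|$ is the Euclidean norm). For a continuous $x:[t_0-\tau,T)\to\mathbb R^n$ and $t_0\le t<T$, $x_t\in\mathcal C$ is $x_t(s)=x(t+s)$. $\mathcal U$ is the set of locally bounded Lebesgue measurable functions $u:[0,\infty)\to\mathbb R^m$; $\mathbf 0\in\mathcal U$ is the zero input. Standing assumptions: $f(t,\cdot,\cdot)$ is continuous for every $t\ge0$; $f(\cdot,\psi,\mu)$ is Lebesgue measurable for every $(\psi,\mu)$; and for every $t_0\ge0$, $\psi\in\mathcal C$, $u\in\mathcal U$ there is a unique maximally defined continuous $x:[t_0-\tau,t_{(t_0,\psi,u)})\to\mathbb R^n$, $t_{(t_0,\psi,u)}>t_0$, with $x_{t_0}=\psi$, locally absolutely continuous on $[t_0,t_{(t_0,\psi,u)})$ and satisfying $\dot x(t)=f(t,x_t,u(t))$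 for almost all $t$ there; this is the solution corresponding to initial time $t_0$, initial state $\psi$ and input $u$. Notation. For $\kappa\in\mathcal K_\infty$ and $u\in\mathcal U$, $\|u\|_\kappa=\int_0^\infty\kappa(|u(s)|)\,ds$; $u_{(t_0,t]}$ equals $u$ on $(t_0,t]$ and $0$ elsewhere, so $\|u_{(t_0,t]}\|_\kappa=\int_{t_0}^t\kappa(|u(s)|)\,ds$. Stability notions (each bound is required for all $t\ge t_0$, which includes that the solution exists for all $t\ge t_0$). 0-GUAS: there is $\beta\in\mathcal{KL}$ such that the solution for any $t_0\ge0$, $\psi\in\mathcal C$ and $u=\mathbf 0$ satisfies $|x(t)|\le\beta(\|\psi\|,t-t_0)$. UBEBS with gain $\kappa\in\mathcal K_\infty$: there are $\alpha',\rho\in\mathcal K_\infty$ and $c\ge0$ such that for all $t_0\ge0$, $\psi\in\mathcal C$, $u\in\mathcal U$, the solution satisfies $|x(t)|\le\alpha'(\|\psi\|)+\rho(\|u_{(t_0,t]}\|_\kappa)+c$. iISS with gain $\kappa\in\mathcal K_\infty$: there are $\beta\in\mathcal{KL}$, $\rho\in\mathcal K_\infty$ such that for all $t_0\ge0$, $\psi\in\mathcal C$, $u\in\mathcal U$, the solution satisfies $|x(t)|\le\beta(\|\psi\|,t-t_0)+\rho(\|u_{(t_0,t]}\|_\kappa)$. *)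

theory Defs
  imports "HOL-Analysis.Analysis"
begin

(* Functions with domain [0,\<infinity>) are rendered as functions on all of real of which only the
   values on {0..} matter. *)

definition class_K :: "(real \<Rightarrow> real) \<Rightarrow> bool" where
  "class_K \<alpha> \<longleftrightarrow> continuous_on {0..} \<alpha> \<and> strict_mono_on {0..} \<alpha> \<and> \<alpha> 0 = 0"

definition class_Kinf :: "(real \<Rightarrow> real) \<Rightarrow> bool" where
  "class_Kinf \<alpha> \<longleftrightarrow> class_K \<alpha> \<and> \<not> bdd_above (\<alpha> ` {0..})"

definition class_KL :: "(real \<Rightarrow> real \<Rightarrow> real) \<Rightarrow> bool" where
  "class_KL \<beta> \<longleftrightarrow>
     (\<forall>t\<ge>0. class_K (\<lambda>r. \<beta> r t)) \<and>
     (\<forall>r\<ge>0. antimono_on {0..} (\<beta> r) \<and> (\<beta> r \<longlongrightarrow> 0) at_top)"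

(* C([-\<tau>,0], R^n) with the metric of the supremum norm; its points are real functions that
   are "undefined" outside [-\<tau>,0], so that they are determined by their values on [-\<tau>,0]. *)
definition hist_metric :: "real \<Rightarrow> (real \<Rightarrow> real ^ 'n) metric" where
  "hist_metric \<tau> = cfunspace (top_of_set {-\<tau>..0}) euclidean_metric"

definition hist_space :: "real \<Rightarrow> (real \<Rightarrow> real ^ 'n) set" where
  "hist_space \<tau> = mspace (hist_metric \<tau>)"

definition sup_norm :: "real \<Rightarrow> (real \<Rightarrow> real ^ 'n) \<Rightarrow> real" where
  "sup_norm \<tau> \<psi> = (SUP s\<in>{-\<tau>..0}. norm (\<psi> s))"

definition history :: "real \<Rightarrow> (real \<Rightarrow> real ^ 'n) \<Rightarrow> real \<Rightarrow> (real \<Rightarrow> real ^ 'n)" where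
  "history \<tau> x t = restrict (\<lambda>s. x (t + s)) {-\<tau>..0}"

definition inputs :: "(real \<Rightarrow> real ^ 'm) set" where
  "inputs = {u. u \<in> borel_measurable (lebesgue_on {0..}) \<and> (\<forall>T\<ge>0. bounded (u ` {0..T}))}"

definition truncate_input :: "(real \<Rightarrow> real ^ 'm) \<Rightarrow> real \<Rightarrow> real \<Rightarrow> (real \<Rightarrow> real ^ 'm)" where
  "truncate_input u t0 t = (\<lambda>s. if s \<in> {t0<..t} then u s else 0)"

definition input_energy :: "(real \<Rightarrow> real) \<Rightarrow> (real \<Rightarrow> real ^ 'm) \<Rightarrow> ennreal" where
  "input_energy \<kappa> u = (\<integral>\<^sup>+s\<in>{0..}. ennreal (\<kappa> (norm (u s))) \<partial>lebesgue)"

(* Finite families of non-overlapping compact subintervals of I are encoded as divisions of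
   subsets S of I: the member K is the interval [Inf K, Sup K]. *)
definition abs_continuous_on :: "real set \<Rightarrow> (real \<Rightarrow> real ^ 'n) \<Rightarrow> bool" where
  "abs_continuous_on I x \<longleftrightarrow>
     (\<forall>\<epsilon>>0. \<exists>\<delta>>0. \<forall>D S. D division_of S \<and> S \<subseteq> I \<and> (\<Sum>K\<in>D. Sup K - Inf K) < \<delta> \<longrightarrow>
        (\<Sum>K\<in>D. norm (x (Sup K) - x (Inf K))) < \<epsilon>)"

type_synonym ('n, 'm) rhs = "real \<Rightarrow> (real \<Rightarrow> real ^ 'n) \<Rightarrow> real ^ 'm \<Rightarrow> real ^ 'n"

definition sol_dom :: "real \<Rightarrow> real \<Rightarrow> ereal \<Rightarrow> real set" where
  "sol_dom \<tau> t0 T = {s. t0 - \<tau> \<le> s \<and> ereal s < T}"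

definition is_solution ::
  "real \<Rightarrow> ('n::finite, 'm::finite) rhs \<Rightarrow> real \<Rightarrow> (real \<Rightarrow> real ^ 'n) \<Rightarrow> (real \<Rightarrow> real ^ 'm) \<Rightarrow>
     ereal \<Rightarrow> (real \<Rightarrow> real ^ 'n) \<Rightarrow> bool" where
  "is_solution \<tau> f t0 \<psi> u T x \<longleftrightarrow>
     ereal t0 < T \<and>
     continuous_on (sol_dom \<tau> t0 T) x \<and>
     history \<tau> x t0 = \<psi> \<and>
     (\<forall>b. t0 \<le> b \<and> ereal b < T \<longrightarrow> abs_continuous_on {t0..b} x) \<and>
     (AE t in lebesgue. t0 < t \<and> ereal t < T \<longrightarrow>
        (x has_vector_derivative f t (history \<tau> x t) (u t)) (at t))"

definition is_max_solution ::
  "real \<Rightarrow> ('n::finite, 'm::finite) rhs \<Rightarrow> real \<Rightarrow> (real \<Rightarrow> real ^ 'n) \<Rightarrow> (real \<Rightarrow> real ^ 'm) \<Rightarrow>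
     ereal \<Rightarrow> (real \<Rightarrow> real ^ 'n) \<Rightarrow> bool" where
  "is_max_solution \<tau> f t0 \<psi> u T x \<longleftrightarrow>
     is_solution \<tau> f t0 \<psi> u T x \<and>
     (\<forall>T' y. is_solution \<tau> f t0 \<psi> u T' y \<and> T \<le> T' \<and> (\<forall>s\<in>sol_dom \<tau> t0 T. y s = x s) \<longrightarrow> T' = T)"

definition time_delay_system :: "real \<Rightarrow> ('n::finite, 'm::finite) rhs \<Rightarrow> bool" where
  "time_delay_system \<tau> f \<longleftrightarrow>
     0 \<le> \<tau> \<and>
     (\<forall>t\<ge>0. continuous_map (prod_topology (mtopology_of (hist_metric \<tau>)) euclidean) euclidean
        (\<lambda>(\<psi>, \<mu>). f t \<psi> \<mu>)) \<and>
     (\<forall>\<psi>\<in>hist_space \<tau>. \<forall>\<mu>. (\<lambda>t. f t \<psi> \<mu>) \<in> borel_measurable (lebesgue_on {0..})) \<and>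
     (\<forall>t0\<ge>0. \<forall>\<psi>\<in>hist_space \<tau>. \<forall>u\<in>inputs. \<exists>T x. is_max_solution \<tau> f t0 \<psi> u T x \<and>
        (\<forall>T' y. is_max_solution \<tau> f t0 \<psi> u T' y \<longrightarrow>
           T' = T \<and> (\<forall>s\<in>sol_dom \<tau> t0 T. y s = x s)))"

definition cond_R1 :: "real \<Rightarrow> ('n::finite, 'm::finite) rhs \<Rightarrow> (real \<Rightarrow> real) \<Rightarrow> bool" where
  "cond_R1 \<tau> f \<gamma> \<longleftrightarrow>
     class_Kinf \<gamma> \<and>
     (\<exists>N :: real \<Rightarrow> real. mono_on {0..} N \<and> (\<forall>r\<ge>0. 0 < N r) \<and>
        (\<forall>t\<ge>0. \<forall>\<psi>\<in>hist_space \<tau>. \<forall>\<mu>.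
           norm (f t \<psi> \<mu>) \<le> N (sup_norm \<tau> \<psi>) * (1 + \<gamma> (norm \<mu>))))"

definition cond_R2 :: "real \<Rightarrow> ('n::finite, 'm::finite) rhs \<Rightarrow> bool" where
  "cond_R2 \<tau> f \<longleftrightarrow>
     (\<forall>r>0. \<forall>\<epsilon>>0. \<exists>\<delta>>0. \<forall>t\<ge>0. \<forall>\<psi>\<in>hist_space \<tau>. \<forall>\<mu>.
        sup_norm \<tau> \<psi> \<le> r \<and> norm \<mu> \<le> \<delta> \<longrightarrow> norm (f t \<psi> \<mu> - f t \<psi> 0) < \<epsilon>)"

definition cond_R3 :: "real \<Rightarrow> ('n::finite, 'm::finite) rhs \<Rightarrow> bool" where
  "cond_R3 \<tau> f \<longleftrightarrow>
     (\<forall>r>0. \<exists>L :: real. \<forall>t\<ge>0. \<forall>\<psi>\<in>hist_space \<tau>. \<forall>\<phi>\<in>hist_space \<tau>.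
        sup_norm \<tau> \<psi> \<le> r \<and> sup_norm \<tau> \<phi> \<le> r \<longrightarrow>
        norm (f t \<psi> 0 - f t \<phi> 0) \<le> L * sup_norm \<tau> (\<lambda>s. \<psi> s - \<phi> s))"

(* In the stability notions "the solution" is any maximal solution; for a time_delay_system it
   exists and is unique. T = \<infinity> says that it exists for all t \<ge> t0.
   The truncated input is bounded with bounded support, so its energy is finite and enn2real
   loses nothing. *)

definition zero_GUAS :: "real \<Rightarrow> ('n::finite, 'm::finite) rhs \<Rightarrow> bool" where
  "zero_GUAS \<tau> f \<longleftrightarrow>
     (\<exists>\<beta>. class_KL \<beta> \<and>
        (\<forall>t0\<ge>0. \<forall>\<psi>\<in>hist_space \<tau>. \<forall>T x. is_max_solution \<tau> f t0 \<psi> (\<lambda>_. 0) T x \<longrightarrow>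
           T = \<infinity> \<and> (\<forall>t\<ge>t0. norm (x t) \<le> \<beta> (sup_norm \<tau> \<psi>) (t - t0))))"

definition UBEBS :: "real \<Rightarrow> ('n::finite, 'm::finite) rhs \<Rightarrow> (real \<Rightarrow> real) \<Rightarrow> bool" where
  "UBEBS \<tau> f \<kappa> \<longleftrightarrow>
     class_Kinf \<kappa> \<and>
     (\<exists>\<alpha> \<rho>. \<exists>c\<ge>0. class_Kinf \<alpha> \<and> class_Kinf \<rho> \<and>
        (\<forall>t0\<ge>0. \<forall>\<psi>\<in>hist_space \<tau>. \<forall>u\<in>inputs. \<forall>T x. is_max_solution \<tau> f t0 \<psi> u T x \<longrightarrow>
           T = \<infinity> \<and> (\<forall>t\<ge>t0. norm (x t) \<le>
              \<alpha> (sup_norm \<tau> \<psi>) + \<rho> (enn2real (input_energy \<kappa> (truncate_input u t0 t))) + c)))"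

definition iISS :: "real \<Rightarrow> ('n::finite, 'm::finite) rhs \<Rightarrow> (real \<Rightarrow> real) \<Rightarrow> bool" where
  "iISS \<tau> f \<kappa> \<longleftrightarrow>
     class_Kinf \<kappa> \<and>
     (\<exists>\<beta> \<rho>. class_KL \<beta> \<and> class_Kinf \<rho> \<and>
        (\<forall>t0\<ge>0. \<forall>\<psi>\<in>hist_space \<tau>. \<forall>u\<in>inputs. \<forall>T x. is_max_solution \<tau> f t0 \<psi> u T x \<longrightarrow>
           T = \<infinity> \<and> (\<forall>t\<ge>t0. norm (x t) \<le>
              \<beta> (sup_norm \<tau> \<psi>) (t - t0) + \<rho> (enn2real (input_energy \<kappa> (truncate_input u t0 t))))))"

end

theory Submission
  imports Defs
begin

text \<open>
  That iISS implies the other two properties is immediate: for the zero input the energy term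
  vanishes, and \<open>\<beta>(r, t) \<le> \<beta>(r, 0)\<close> bounds the transient by a function of the initial state alone.

  For the converse, let \<open>\<kappa> = max \<alpha> \<gamma>\<close> and measure inputs by their \<open>\<kappa>\<close>-energy. The system is
  compared with the unforced system over time windows of bounded length. As long as the solution
  stays in a ball of radius \<open>r\<close>, (R2) makes the effect of small input values on the right-hand side
  at most \<open>\<epsilon>\<close>, while for larger values (R1) and \<open>\<gamma> \<le> \<kappa>\<close> bound it by a constant times \<open>\<kappa>\<close>
  of the input (\<open>input_effect_bound\<close>). Together with the Lipschitz condition (R3) and a Gronwall argument
  this shows that on a window of length \<open>T\<close> with small enough energy the solution is as close as
  desired to the unforced solution that starts in the same state (\<open>deviation_from_unforced\<close>),
  uniformly in the initial time; so it satisfies the 0-GUAS estimate up to an error \<open>\<eta>\<close>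
  (\<open>near_unforced\<close>). UBEBS supplies the ball in advance. Everything else follows from
  this one fact.

  First, small initial states and small energy give small solutions: choose the window so long that
  the unforced solution halves the size of the state, and iterate over consecutive windows, restarting
  at the beginning of each (\<open>small_data_small_solution\<close>). This removes the constant from the
  UBEBS estimate (\<open>energy_bounded_without_offset\<close>). Second, let the state and the energy be at
  most \<open>r\<close>. Among more than \<open>r / \<delta>\<close> consecutive windows at least one carries energy at most
  \<open>\<delta>\<close>; at its end the state is small, and restarting the offset-free estimate there shows
  that from then on the solution is bounded by \<open>\<epsilon>\<close> plus a function of the energy
  (\<open>attractive\<close>). Finally, bounds of this kind that are uniform in the initial state are turned
  into a class KL estimate by averaging a supremum over \<open>[r, 2 r]\<close> (\<open>class_KL_sum_bound\<close>).
\<close>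

section \<open>Growth of absolutely continuous functions\<close>

text \<open>A one-sided form of the fundamental theorem for absolutely continuous functions, proved with
  gauges: only the majorant \<open>h\<close> is integrated, never the derivative. The proof covers the null set
  \<open>M\<close> by an open set \<open>U\<close> of measure below the \<open>\<delta>\<close> of absolute continuity and takes
  a gauge that keeps intervals tagged in \<open>M\<close> inside \<open>U\<close> and makes the difference quotient accurate
  at every other tag. In a fine tagged division the intervals tagged in \<open>M\<close> then contribute at most
  \<open>e\<close> by absolute continuity, and the others at most a Riemann sum of \<open>h\<close> plus \<open>e (b - a)\<close>.\<close>
lemma abs_continuous_increment_le:
  fixes z :: "real \<Rightarrow> real ^ 'n"
  assumes ac: "abs_continuous_on {a..b} z" and ab: "a \<le> b"
    and I: "(h has_integral I) {a..b}" and M: "negligible M"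
    and deriv: "\<And>t. t \<in> {a..b} - M \<Longrightarrow>
      \<exists>v. (z has_vector_derivative v) (at t within {a..b}) \<and> norm v \<le> h t"
  shows "norm (z b - z a) \<le> I"
proof (rule field_le_epsilon)
  fix e' :: real assume "0 < e'"
  define e where "e = e' / (b - a + 2)"
  have e: "e > 0" using \<open>0 < e'\<close> ab by (simp add: e_def)
  have "e * (b - a + 2) = e'" using ab by (simp add: e_def)
  then have e_sum: "e * (b - a) + e + e = e'" by (simp add: algebra_simps)
  \<comment> \<open>Nothing is known about \<open>h\<close> on \<open>M\<close>; with the value 0 there, tags in \<open>M\<close> drop out of the Riemann sum.\<close>
  define h0 where "h0 t = (if t \<in> M then 0 else h t)" for t
  have h0: "(h0 has_integral I) {a..b}"
    by (rule has_integral_spike[OF M _ I]) (auto simp: h0_def)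
  then obtain g1 where g1: "gauge g1" and riemann: "\<forall>p. p tagged_division_of {a..b} \<and> g1 fine p \<longrightarrow>
      norm ((\<Sum>(t, K)\<in>p. measure lborel K *\<^sub>R h0 t) - I) < e"
    using h0[unfolded has_integral_real, THEN spec, THEN mp, OF e] by (elim exE conjE)
  obtain \<delta> where "\<delta> > 0" and \<delta>: "\<forall>D S. D division_of S \<and> S \<subseteq> {a..b} \<and>
      (\<Sum>K\<in>D. Sup K - Inf K) < \<delta> \<longrightarrow> (\<Sum>K\<in>D. norm (z (Sup K) - z (Inf K))) < e"
    using ac[unfolded abs_continuous_on_def, THEN spec, THEN mp, OF e] by (elim exE conjE)
  have "M \<in> sets lebesgue"
    using M negligible_imp_sets by blast
  obtain U where "open U" "M \<subseteq> U" "U - M \<in> lmeasurable" "emeasure lebesgue (U - M) < ennreal \<delta>"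
    by (rule sets_lebesgue_outer_open[OF \<open>M \<in> sets lebesgue\<close> \<open>\<delta> > 0\<close>])
  moreover have "M \<in> lmeasurable" "measure lebesgue M = 0"
    using M negligible_iff_measure by auto
  ultimately have U: "U \<in> lmeasurable" "measure lebesgue U < \<delta>"
  proof -
    have eq: "U = (U - M) \<union> M" using \<open>M \<subseteq> U\<close> by auto
    show "U \<in> lmeasurable"
      by (subst eq, rule fmeasurable.Un) fact+
    have "measure lebesgue U \<le> measure lebesgue (U - M) + measure lebesgue M"
      by (subst eq, rule measure_Un_le) (use \<open>U - M \<in> lmeasurable\<close> \<open>M \<in> sets lebesgue\<close> in auto)
    also have "\<dots> < \<delta>"
      using \<open>emeasure lebesgue (U - M) < ennreal \<delta>\<close> \<open>measure lebesgue M = 0\<close> \<open>\<delta> > 0\<close>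
        emeasure_eq_measure2[OF \<open>U - M \<in> lmeasurable\<close>]
      by (simp add: ennreal_less_iff)
    finally show "measure lebesgue U < \<delta>" .
  qed
  have "\<exists>d>0. \<forall>y\<in>{a..b}. \<bar>y - t\<bar> < d \<longrightarrow> norm (z y - z t) \<le> (h t + e) * \<bar>y - t\<bar>"
    if t: "t \<in> {a..b} - M" for t
  proof -
    obtain v where v: "(z has_vector_derivative v) (at t within {a..b})" "norm v \<le> h t"
      using deriv[OF t] by blast
    then obtain d where "d > 0" and d: "\<And>y. y \<in> {a..b} \<Longrightarrow> norm (y - t) < d \<Longrightarrow>
        norm (z y - z t - (y - t) *\<^sub>R v) \<le> e * norm (y - t)"
      using v(1)[unfolded has_vector_derivative_def has_derivative_within_alt, THEN conjunct2, THEN spec, THEN mp, OF e]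
      by (elim exE conjE) (auto intro: that)
    have "norm (z y - z t) \<le> (h t + e) * \<bar>y - t\<bar>" if "y \<in> {a..b}" "\<bar>y - t\<bar> < d" for y
    proof -
      have "norm (z y - z t) \<le> norm (z y - z t - (y - t) *\<^sub>R v) + norm ((y - t) *\<^sub>R v)"
        using norm_triangle_ineq[of "z y - z t - (y - t) *\<^sub>R v" "(y - t) *\<^sub>R v"] by simp
      also have "\<dots> \<le> e * \<bar>y - t\<bar> + \<bar>y - t\<bar> * h t"
        using d[OF that(1)] that(2) v(2) by (intro add_mono) (auto intro: mult_left_mono)
      finally show ?thesis by (simp add: algebra_simps)
    qed
    then show ?thesis using \<open>d > 0\<close> by blast
  qed
  then obtain d where d: "\<And>t. t \<in> {a..b} - M \<Longrightarrow> d t > 0"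
    "\<And>t y. t \<in> {a..b} - M \<Longrightarrow> y \<in> {a..b} \<Longrightarrow> \<bar>y - t\<bar> < d t \<Longrightarrow> norm (z y - z t) \<le> (h t + e) * \<bar>y - t\<bar>"
    by metis
  define g2 where "g2 t = (if t \<in> M then U else if t \<in> {a..b} then ball t (d t) else UNIV)" for t
  have "gauge g2"
    using \<open>open U\<close> \<open>M \<subseteq> U\<close> d(1) by (auto simp: gauge_def g2_def)
  then have "gauge (\<lambda>t. g1 t \<inter> g2 t)" using g1 by auto
  then obtain p where p: "p tagged_division_of {a..b}" and fine: "(\<lambda>t. g1 t \<inter> g2 t) fine p"
    using fine_division_exists_real by blast
  have fine1: "g1 fine p" and fine2: "\<And>t K. (t, K) \<in> p \<Longrightarrow> K \<subseteq> g2 t"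
    using fine by (auto simp: fine_def)
  have finp: "finite p" using p by blast
  have elem: "\<exists>u v. K = {u..v} \<and> t \<in> {u..v} \<and> {u..v} \<subseteq> {a..b}" if "(t, K) \<in> p" for t K
    using tagged_division_ofD(2-4)[OF p that] by (metis box_real(2))
  define q where "q = {(t, K) \<in> p. t \<in> M}"
  have q: "q \<subseteq> p" by (auto simp: q_def)
  let ?inc = "\<lambda>(t::real, K). norm (z (Sup K) - z (Inf K))"
  have td: "q tagged_division_of (\<Union>(snd ` q))"
    using p q tagged_partial_division_of_Union_self tagged_partial_division_subset
      tagged_division_of_def by blast
  have div: "(snd ` q) division_of (\<Union>(snd ` q))"
    by (rule division_of_tagged_division[OF td])
  \<comment> \<open>The sum over tagged intervals may visit a degenerate interval twice, so the summand
    must vanish on intervals with empty interior; for the empty set this is not automatic.\<close>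
  have ne: "K \<noteq> {}" if "(t, K) \<in> q" for t K
    using elem[of t K] q that by fastforce
  have "sum ?inc q = (\<Sum>(t, K)\<in>q. if K = {} then 0 else norm (z (Sup K) - z (Inf K)))"
    using ne by (intro sum.cong) auto
  also have "\<dots> = (\<Sum>K\<in>snd ` q. if K = {} then 0 else norm (z (Sup K) - z (Inf K)))"
    by (rule sum.over_tagged_division_lemma[OF td]) auto
  also have "\<dots> = (\<Sum>K\<in>snd ` q. norm (z (Sup K) - z (Inf K)))"
    using ne by (intro sum.cong) auto
  also have "\<dots> < e"
  proof (rule \<delta>[rule_format, OF conjI, OF div conjI])
    show "\<Union> (snd ` q) \<subseteq> {a..b}"
      using elem q by fastforce
    have "(\<Sum>K\<in>snd ` q. Sup K - Inf K) = (\<Sum>K\<in>snd ` q. measure lebesgue K)"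
      using elem q by (intro sum.cong) fastforce+
    also have "\<dots> = measure lebesgue (\<Union>(snd ` q))"
      by (rule content_division[OF div])
    also have "\<dots> \<le> measure lebesgue U"
    proof (rule measure_mono_fmeasurable)
      show "\<Union> (snd ` q) \<subseteq> U"
        using fine2 by (fastforce simp: q_def g2_def)
      show "\<Union> (snd ` q) \<in> sets lebesgue"
        using lmeasurable_division[OF div] by auto
    qed (rule U)
    finally show "(\<Sum>K\<in>snd ` q. Sup K - Inf K) < \<delta>" using U by simp
  qed
  finally have sum_q: "sum ?inc q < e" .
  have "?inc tK \<le> (\<lambda>(t, K). measure lborel K *\<^sub>R h0 t + e * measure lborel K) tK" if tK: "tK \<in> p - q" for tK
  proof -
    obtain t K where [simp]: "tK = (t, K)" by force
    have tp: "(t, K) \<in> p" "t \<notin> M" using tK by (auto simp: q_def)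
    obtain u v where K: "K = {u..v}" and t: "t \<in> {u..v}" and uv: "{u..v} \<subseteq> {a..b}"
      using elem[OF tp(1)] by blast
    have ta: "t \<in> {a..b} - M" using t uv tp by auto
    have "K \<subseteq> ball t (d t)" using fine2[OF tp(1)] ta by (auto simp: g2_def)
    moreover have "u \<in> K" "v \<in> K" using K t by auto
    ultimately have near: "\<bar>u - t\<bar> < d t" "\<bar>v - t\<bar> < d t"
      by (auto simp: subset_iff dist_real_def abs_minus_commute)
    have "norm (z v - z u) \<le> norm (z v - z t) + norm (z u - z t)"
      by norm
    also have "\<dots> \<le> (h t + e) * \<bar>v - t\<bar> + (h t + e) * \<bar>u - t\<bar>"
      using t uv near by (intro add_mono d(2)[OF ta]) auto
    also have "\<dots> = (h t + e) * (v - u)" using t by (simp add: algebra_simps)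
    also have "\<dots> = (v - u) * h0 t + e * (v - u)" using tp by (simp add: h0_def algebra_simps)
    finally show ?thesis using K t by simp
  qed
  then have "sum ?inc (p - q) \<le> (\<Sum>(t, K)\<in>p - q. measure lborel K *\<^sub>R h0 t + e * measure lborel K)"
    by (rule sum_mono)
  also have "\<dots> = (\<Sum>(t, K)\<in>p - q. measure lborel K *\<^sub>R h0 t) + (\<Sum>(t, K)\<in>p - q. e * measure lborel K)"
    by (simp add: case_prod_unfold sum.distrib)
  also have "(\<Sum>(t, K)\<in>p - q. measure lborel K *\<^sub>R h0 t) = (\<Sum>(t, K)\<in>p. measure lborel K *\<^sub>R h0 t)"
    by (rule sum.mono_neutral_left) (use finp in \<open>auto simp: q_def h0_def\<close>)
  also have "(\<Sum>(t, K)\<in>p - q. e * measure lborel K) \<le> (\<Sum>(t, K)\<in>p. e * measure lborel K)"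
    by (rule sum_mono2) (use finp e in auto)
  also have "(\<Sum>(t, K)\<in>p. e * measure lborel K) = e * (b - a)"
    using additive_content_tagged_division[of p a b] p ab
    by (simp add: case_prod_unfold flip: sum_distrib_left)
  also have "(\<Sum>(t, K)\<in>p. measure lborel K *\<^sub>R h0 t) \<le> I + e"
    using riemann[THEN spec, THEN mp, OF conjI, OF p fine1] unfolding real_norm_def by linarith
  finally have sum_pq: "sum ?inc (p - q) \<le> I + e + e * (b - a)" by simp
  have "z b - z a = (\<Sum>(t, K)\<in>p. z (Sup K) - z (Inf K))"
    using additive_tagged_division_1[OF ab p, of z] by simp
  also have "norm \<dots> \<le> sum ?inc p"
    using norm_sum[of "\<lambda>(t, K). z (Sup K) - z (Inf K)" p] by (simp add: case_prod_unfold)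
  also have "\<dots> = sum ?inc (p - q) + sum ?inc q"
    by (rule sum.subset_diff[OF q finp])
  finally show "norm (z b - z a) \<le> I + e'" using sum_q sum_pq e_sum by linarith
qed

lemma abs_continuous_on_subset: "abs_continuous_on I x \<Longrightarrow> J \<subseteq> I \<Longrightarrow> abs_continuous_on J x"
  unfolding abs_continuous_on_def by (meson order_trans)

lemma abs_continuous_on_diff:
  assumes x: "abs_continuous_on I x" and y: "abs_continuous_on I y"
  shows "abs_continuous_on I (\<lambda>t. x t - y t)"
  unfolding abs_continuous_on_def
proof (intro allI impI)
  fix \<epsilon> :: real assume "0 < \<epsilon>"
  then have "0 < \<epsilon> / 2" by simp
  obtain \<delta>1 where "\<delta>1 > 0" and \<delta>1: "\<forall>D S. D division_of S \<and> S \<subseteq> I \<and> (\<Sum>K\<in>D. Sup K - Inf K) < \<delta>1 \<longrightarrow>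
      (\<Sum>K\<in>D. norm (x (Sup K) - x (Inf K))) < \<epsilon> / 2"
    using x[unfolded abs_continuous_on_def, THEN spec, THEN mp, OF \<open>0 < \<epsilon> / 2\<close>] by (elim exE conjE)
  obtain \<delta>2 where "\<delta>2 > 0" and \<delta>2: "\<forall>D S. D division_of S \<and> S \<subseteq> I \<and> (\<Sum>K\<in>D. Sup K - Inf K) < \<delta>2 \<longrightarrow>
      (\<Sum>K\<in>D. norm (y (Sup K) - y (Inf K))) < \<epsilon> / 2"
    using y[unfolded abs_continuous_on_def, THEN spec, THEN mp, OF \<open>0 < \<epsilon> / 2\<close>] by (elim exE conjE)
  have "(\<Sum>K\<in>D. norm (x (Sup K) - y (Sup K) - (x (Inf K) - y (Inf K)))) < \<epsilon>"
    if D: "D division_of S" "S \<subseteq> I" and sum: "(\<Sum>K\<in>D. Sup K - Inf K) < min \<delta>1 \<delta>2" for D S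
  proof -
    have "(\<Sum>K\<in>D. norm (x (Sup K) - y (Sup K) - (x (Inf K) - y (Inf K))))
        \<le> (\<Sum>K\<in>D. norm (x (Sup K) - x (Inf K)) + norm (y (Sup K) - y (Inf K)))"
      by (intro sum_mono) norm
    also have "\<dots> < \<epsilon> / 2 + \<epsilon> / 2"
      unfolding sum.distrib using D sum
      by (intro add_strict_mono \<delta>1[THEN spec, THEN spec, THEN mp] \<delta>2[THEN spec, THEN spec, THEN mp]) auto
    finally show ?thesis by simp
  qed
  then show "\<exists>\<delta>>0. \<forall>D S. D division_of S \<and> S \<subseteq> I \<and> (\<Sum>K\<in>D. Sup K - Inf K) < \<delta> \<longrightarrow>
      (\<Sum>K\<in>D. norm (x (Sup K) - y (Sup K) - (x (Inf K) - y (Inf K)))) < \<epsilon>"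
    using \<open>\<delta>1 > 0\<close> \<open>\<delta>2 > 0\<close> by (intro exI[of _ "min \<delta>1 \<delta>2"]) auto
qed

text \<open>The derivative of \<open>z\<close> at time \<open>t\<close> is controlled by the whole past of \<open>z\<close>, as for a difference of
  two solutions of a delay equation with the same initial state. Instead of iterating an integral
  inequality, consider a time \<open>c\<close> where \<open>norm (z t) / exp (2 L (t - a))\<close> attains its maximum \<open>m\<close>. Up to
  \<open>c\<close> the increasing function \<open>m exp (2 L (t - a))\<close> dominates the past of \<open>z\<close>, and its integral times
  \<open>L\<close> is at most half its final value; so half of \<open>norm (z c)\<close> can be absorbed, leaving \<open>m \<le> 2 A\<close>.\<close>
lemma delay_gronwall:
  fixes z :: "real \<Rightarrow> real ^ 'n"
  assumes ab: "a \<le> b" and L: "0 < L"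
    and ac: "abs_continuous_on {a..b} z" and cont: "continuous_on {a..b} z" and z0: "z a = 0"
    and g: "g integrable_on {a..b}" "\<And>t. t \<in> {a..b} \<Longrightarrow> 0 \<le> g t" "integral {a..b} g \<le> A"
    and M: "negligible M"
    and deriv: "\<And>t w. t \<in> {a..b} - M \<Longrightarrow> (\<And>s. s \<in> {a..t} \<Longrightarrow> norm (z s) \<le> w) \<Longrightarrow>
      \<exists>v. (z has_vector_derivative v) (at t within {a..b}) \<and> norm v \<le> g t + L * w"
  shows "norm (z b) \<le> 2 * A * exp (2 * L * (b - a))"
proof -
  define E where "E t = exp (2 * L * (t - a))" for t
  have E_pos: "0 < E t" for t by (simp add: E_def)
  have quot: "continuous_on {a..b} (\<lambda>t. norm (z t) / E t)"
    using cont by (intro continuous_intros) (auto simp: E_def intro!: continuous_intros)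
  have "{a..b} \<noteq> {}" using ab by simp
  then obtain c where c: "c \<in> {a..b}"
    and c_max: "\<forall>t\<in>{a..b}. norm (z t) / E t \<le> norm (z c) / E c"
    using continuous_attains_sup[OF compact_Icc _ quot] by blast
  define m where "m = norm (z c) / E c"
  have m: "0 \<le> m" using E_pos[of c] by (simp add: m_def)
  have z_le: "norm (z t) \<le> m * E t" if "t \<in> {a..b}" for t
    using c_max[rule_format, OF that] E_pos[of t] by (simp add: m_def[symmetric] pos_divide_le_eq)
  have ac': "{a..c} \<subseteq> {a..b}" "a \<le> c" using c by auto
  have g_int: "g integrable_on {a..c}"
    using g(1) ac'(1) by (rule integrable_on_subinterval)
  have "((\<lambda>t. L * (m * E t)) has_integral (m / 2 * E c - m / 2 * E a)) {a..c}"
    using ac'(2) L by (intro fundamental_theorem_of_calculus)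
      (auto simp: E_def has_real_derivative_iff_has_vector_derivative[symmetric] intro!: derivative_eq_intros)
  then have h: "((\<lambda>t. g t + L * (m * E t)) has_integral
      (integral {a..c} g + (m / 2 * E c - m / 2 * E a))) {a..c}"
    using g_int by (intro has_integral_add) auto
  have "norm (z c - z a) \<le> integral {a..c} g + (m / 2 * E c - m / 2 * E a)"
  proof (rule abs_continuous_increment_le[OF abs_continuous_on_subset[OF ac ac'(1)] ac'(2) h M])
    fix t assume t: "t \<in> {a..c} - M"
    have "norm (z s) \<le> m * E t" if "s \<in> {a..t}" for s
    proof -
      have "norm (z s) \<le> m * E s" using that t c by (intro z_le) auto
      also have "\<dots> \<le> m * E t"
        using that L m by (intro mult_left_mono) (auto simp: E_def)
      finally show ?thesis .
    qed
    then obtain v where "(z has_vector_derivative v) (at t within {a..b})" "norm v \<le> g t + L * (m * E t)"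
      using deriv[of t "m * E t"] t c by auto
    then show "\<exists>v. (z has_vector_derivative v) (at t within {a..c}) \<and> norm v \<le> g t + L * (m * E t)"
      using has_vector_derivative_within_subset ac'(1) by blast
  qed
  moreover have "integral {a..c} g \<le> A"
    using integral_subset_le[OF ac'(1) g_int g(1)] g(2,3) by force
  moreover have "E a = 1" by (simp add: E_def)
  moreover have "norm (z c) = m * E c" using E_pos[of c] by (simp add: m_def)
  ultimately have "m * E c \<le> 2 * A"
    using z0 m by simp
  moreover have "m \<le> m * E c"
    using m L ac'(2) by (simp add: E_def mult_le_cancel_left1)
  ultimately have "m * E b \<le> 2 * A * E b"
    using E_pos[of b] by simp
  moreover have "norm (z b) \<le> m * E b" using z_le[of b] ab by simp
  ultimately show ?thesis unfolding E_def by linarith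
qed

section \<open>Comparison functions from uniform bounds\<close>

lemma class_K_nonneg: "class_K a \<Longrightarrow> 0 \<le> r \<Longrightarrow> 0 \<le> a r"
  unfolding class_K_def strict_mono_on_def by (metis atLeast_iff order_le_less order_refl)

lemma class_K_mono: "class_K a \<Longrightarrow> 0 \<le> r \<Longrightarrow> r \<le> r' \<Longrightarrow> a r \<le> a r'"
  unfolding class_K_def strict_mono_on_def by (metis atLeast_iff order_le_less order_trans)

lemma class_K_pos: "class_K a \<Longrightarrow> 0 < r \<Longrightarrow> 0 < a r"
  unfolding class_K_def strict_mono_on_def by (metis atLeast_iff order_le_less order_refl)

lemma class_K_small:
  assumes "class_K a" "0 < \<epsilon>"
  shows "\<exists>\<delta>>0. \<forall>r. 0 \<le> r \<and> r \<le> \<delta> \<longrightarrow> a r \<le> \<epsilon>"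
proof -
  have "continuous_on {0..} a" "a 0 = 0"
    using assms(1) by (auto simp: class_K_def)
  then obtain \<delta> where "\<delta> > 0" and \<delta>: "\<And>r. r \<in> {0..} \<Longrightarrow> dist r 0 < \<delta> \<Longrightarrow> dist (a r) (a 0) < \<epsilon>"
    using assms(2) unfolding continuous_on_iff by (metis atLeast_iff order_refl)
  have "a r \<le> \<epsilon>" if "0 \<le> r" "r \<le> \<delta> / 2" for r
    using \<delta>[of r] that \<open>a 0 = 0\<close> \<open>\<delta> > 0\<close> by (auto simp: dist_real_def)
  then show ?thesis using \<open>\<delta> > 0\<close> by (intro exI[of _ "\<delta> / 2"]) auto
qed

lemma class_KinfI:
  assumes K: "class_K b" and a: "class_Kinf a" and ab: "\<And>r. 0 \<le> r \<Longrightarrow> a r \<le> b r"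
  shows "class_Kinf b"
proof -
  have "\<not> bdd_above (b ` {0..})"
  proof
    assume "bdd_above (b ` {0..})"
    then obtain B where "\<And>r. 0 \<le> r \<Longrightarrow> b r \<le> B" by (auto simp: bdd_above_def)
    then have "bdd_above (a ` {0..})"
      using ab by (intro bdd_aboveI2[of _ _ B]) (auto intro: order_trans)
    then show False using a by (simp add: class_Kinf_def)
  qed
  then show ?thesis using K by (simp add: class_Kinf_def)
qed

lemma class_K_add: "class_K a \<Longrightarrow> class_K b \<Longrightarrow> class_K (\<lambda>r. a r + b r)"
  unfolding class_K_def by (auto intro!: continuous_on_add simp: strict_mono_on_def add_strict_mono)

lemma class_K_max:
  assumes "class_K a" "class_K b" shows "class_K (\<lambda>r. max (a r) (b r))"
proof -
  have "max (a r) (b r) < max (a s) (b s)" if "0 \<le> r" "r < s" for r s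
  proof -
    have "a r < a s" "b r < b s"
      using assms that by (auto simp: class_K_def strict_mono_on_def)
    then show ?thesis by auto
  qed
  then show ?thesis
    using assms unfolding class_K_def by (auto intro!: continuous_on_max strict_mono_onI)
qed

lemma class_Kinf_id: "class_Kinf (\<lambda>r. r)"
proof -
  have "\<not> bdd_above {0::real..}"
    by (metis bdd_above_def atLeast_iff gt_ex less_max_iff_disj max.cobounded1 not_le)
  then show ?thesis
    by (auto simp: class_Kinf_def class_K_def strict_mono_on_def)
qed

text \<open>For \<open>r > 0\<close> this is the mean value of \<open>g\<close> over \<open>[r, 2 r]\<close>. For a nondecreasing \<open>g\<close> it lies between
  \<open>g r\<close> and \<open>g (2 r)\<close>, depends monotonically on \<open>r\<close> and on \<open>g\<close>, and is continuous for \<open>r > 0\<close> even if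
  \<open>g\<close> jumps. This makes it a way to replace a supremum by a continuous majorant with the same
  behaviour at \<open>0\<close>. The integral over the fixed interval \<open>[1, 2]\<close> makes monotonicity evident and gives
  the right value at \<open>r = 0\<close>.\<close>
definition doubling_average :: "(real \<Rightarrow> real) \<Rightarrow> real \<Rightarrow> real" where
  "doubling_average g r = integral {1..2} (\<lambda>s. g (r * s))"

context
  fixes g :: "real \<Rightarrow> real"
  assumes mono: "mono_on {0..} g"
begin

lemma doubling_average_integrable: "0 \<le> r \<Longrightarrow> (\<lambda>s. g (r * s)) integrable_on {1..2}"
  by (intro integrable_on_mono_on mono_onI mono_onD[OF mono]) (auto intro: mult_left_mono)

lemma le_doubling_average:
  assumes "0 \<le> r" shows "g r \<le> doubling_average g r"
proof -
  have "integral {1..2} (\<lambda>s::real. g r) \<le> doubling_average g r"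
    unfolding doubling_average_def using assms
    by (intro integral_le doubling_average_integrable mono_onD[OF mono])
      (auto simp: mult_le_cancel_left1)
  then show ?thesis by simp
qed

lemma doubling_average_le:
  assumes "0 \<le> r" shows "doubling_average g r \<le> g (2 * r)"
proof -
  have "doubling_average g r \<le> integral {1..2} (\<lambda>s::real. g (2 * r))"
    unfolding doubling_average_def using assms
    by (intro integral_le doubling_average_integrable mono_onD[OF mono])
      (auto simp: mult.commute[of r] intro: mult_right_mono)
  then show ?thesis by simp
qed

lemma doubling_average_mono: "0 \<le> r \<Longrightarrow> r \<le> r' \<Longrightarrow> doubling_average g r \<le> doubling_average g r'"
  unfolding doubling_average_def
  by (intro integral_le doubling_average_integrable mono_onD[OF mono]) (auto intro: mult_right_mono)

text \<open>The substitution \<open>x = r s\<close> exhibits the average through the indefinite integral of \<open>g\<close>, which is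
  continuous although \<open>g\<close> need not be.\<close>
lemma doubling_average_eq:
  assumes "0 < r"
  shows "doubling_average g r = (integral {0..2 * r} g - integral {0..r} g) / r"
proof -
  have int: "g integrable_on {0..b}" for b
    using mono by (intro integrable_on_mono_on) (auto simp: mono_on_def)
  have "(g has_integral (integral {r..2 * r} g)) {r..2 * r}"
    by (intro integrable_integral integrable_subinterval_real[OF int[of "2 * r"]]) (use assms in auto)
  then have "((\<lambda>s. g (r * s + 0)) has_integral (1 / \<bar>r\<bar> ^ DIM(real)) *\<^sub>R integral {r..2 * r} g)
      ((\<lambda>s. (1 / r) *\<^sub>R s + - ((1 / r) *\<^sub>R 0)) ` cbox r (2 * r))"
    using has_integral_affinity[of g "integral {r..2 * r} g" r "2 * r" r 0] assms by simp
  moreover have "(\<lambda>s. (1 / r) *\<^sub>R s + - ((1 / r) *\<^sub>R 0)) ` cbox r (2 * r) = {1..2}"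
    using assms image_mult_atLeastAtMost[of "1 / r" r "2 * r"] by simp
  ultimately have "((\<lambda>s. g (r * s)) has_integral (integral {r..2 * r} g / r)) {1..2}"
    using assms by simp
  moreover have "integral {0..r} g + integral {r..2 * r} g = integral {0..2 * r} g"
    by (rule Henstock_Kurzweil_Integration.integral_combine) (use assms int in auto)
  ultimately show ?thesis
    unfolding doubling_average_def by (metis add_diff_cancel_left' integral_unique)
qed

text \<open>Continuity away from \<open>0\<close> is that of an indefinite integral, continuity at \<open>0\<close> follows from the bound
  by \<open>g (2 r)\<close>, and the linear term turns monotonicity into strict monotonicity.\<close>
lemma class_K_doubling_average:
  assumes nonneg: "\<And>r. 0 \<le> r \<Longrightarrow> 0 \<le> g r"
    and small: "\<And>\<epsilon>. 0 < \<epsilon> \<Longrightarrow> \<exists>\<delta>>0. \<forall>r. 0 \<le> r \<and> r \<le> \<delta> \<longrightarrow> g r \<le> \<epsilon>"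
    and "0 < c"
  shows "class_K (\<lambda>r. doubling_average g r + c * r)"
proof -
  let ?G = "doubling_average g"
  have G_nonneg: "0 \<le> ?G r" if "0 \<le> r" for r
    using nonneg[OF that] le_doubling_average[OF that] by linarith
  have G_small: "\<exists>\<delta>>0. \<forall>r. 0 \<le> r \<and> r \<le> \<delta> \<longrightarrow> ?G r \<le> \<epsilon>" if "0 < \<epsilon>" for \<epsilon>
  proof -
    obtain \<delta> where "\<delta> > 0" "\<And>r. 0 \<le> r \<Longrightarrow> r \<le> \<delta> \<Longrightarrow> g r \<le> \<epsilon>" using small \<open>0 < \<epsilon>\<close> by blast
    then show ?thesis
      by (intro exI[of _ "\<delta> / 2"]) (auto intro: order_trans[OF doubling_average_le])
  qed
  have "?G 0 \<le> 0"
    by (rule field_le_epsilon) (use G_small in fastforce)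
  then have G0: "?G 0 = 0" using G_nonneg[of 0] by simp
  have "continuous (at r within {0..}) ?G" if "0 \<le> r" for r
  proof (cases "r = 0")
    case True
    have "\<exists>\<delta>>0. \<forall>y\<in>{0..}. dist y 0 < \<delta> \<longrightarrow> dist (?G y) (?G 0) < \<epsilon>" if "0 < \<epsilon>" for \<epsilon>
    proof -
      obtain \<delta> where "\<delta> > 0" "\<And>r. 0 \<le> r \<Longrightarrow> r \<le> \<delta> \<Longrightarrow> ?G r \<le> \<epsilon> / 2" using G_small[of "\<epsilon> / 2"] \<open>0 < \<epsilon>\<close> by auto
      then show ?thesis using G_nonneg G0 \<open>0 < \<epsilon>\<close>
        by (intro exI[of _ \<delta>]) (fastforce simp: dist_real_def)
    qed
    then show ?thesis using True
      by (auto simp: continuous_within_eps_delta)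
  next
    case False
    then have "0 < r" using that by simp
    have F: "continuous_on {0..2 * r + 2} (\<lambda>x. integral {0..x} g)"
      using mono by (intro indefinite_integral_continuous_1 integrable_on_mono_on) (auto simp: mono_on_def)
    have "continuous_on {0<..<r + 1} (\<lambda>x. (integral {0..2 * x} g - integral {0..x} g) / x)"
      by (intro continuous_intros continuous_on_compose2[OF F] continuous_on_subset[OF F]) auto
    then have "continuous_on {0<..<r + 1} ?G"
      by (rule continuous_on_eq) (simp add: doubling_average_eq)
    then have "isCont ?G r"
      using \<open>0 < r\<close> by (simp add: continuous_on_eq_continuous_at)
    then show ?thesis by (simp add: continuous_at_imp_continuous_at_within)
  qed
  then have "continuous_on {0..} (\<lambda>r. ?G r + c * r)"
    by (intro continuous_intros) (simp add: continuous_on_eq_continuous_within)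
  moreover have "strict_mono_on {0..} (\<lambda>r. ?G r + c * r)"
    using \<open>0 < c\<close> by (intro strict_mono_onI add_le_less_mono doubling_average_mono) auto
  ultimately show ?thesis
    by (simp add: class_K_def G0)
qed

end

lemma doubling_average_mono_fun:
  assumes "mono_on {0..} g" "mono_on {0..} h" "\<And>s. 0 \<le> s \<Longrightarrow> g s \<le> h s" "0 \<le> r"
  shows "doubling_average g r \<le> doubling_average h r"
  unfolding doubling_average_def
  using doubling_average_integrable[OF assms(1,4)] doubling_average_integrable[OF assms(2,4)] assms(4)
  by (intro integral_le assms(3)) auto

lemma class_KL_K: "class_KL \<beta> \<Longrightarrow> 0 \<le> t \<Longrightarrow> class_K (\<lambda>r. \<beta> r t)"
  by (simp add: class_KL_def)

lemma class_KL_le: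
  assumes "class_KL \<beta>" "0 \<le> r" "r \<le> r'" "0 \<le> t'" "t' \<le> t"
  shows "\<beta> r t \<le> \<beta> r' t'"
proof -
  have "\<beta> r t \<le> \<beta> r t'"
    using assms by (auto simp: class_KL_def monotone_on_def)
  also have "\<dots> \<le> \<beta> r' t'"
    using class_K_mono[OF class_KL_K[OF assms(1,4)] assms(2,3)] .
  finally show ?thesis .
qed

lemma class_KL_eventually_small:
  assumes "class_KL \<beta>" "0 \<le> r" "0 < \<epsilon>"
  shows "\<exists>T\<ge>0. \<beta> r T \<le> \<epsilon>"
proof -
  have "(\<beta> r \<longlongrightarrow> 0) at_top" using assms by (auto simp: class_KL_def)
  then have "\<forall>\<^sub>F t in at_top. \<beta> r t < \<epsilon>" using assms(3) by (rule order_tendstoD)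
  then have "\<forall>\<^sub>F t in at_top. \<beta> r t < \<epsilon> \<and> 0 \<le> t"
    using eventually_ge_at_top by (rule eventually_conj)
  then obtain T where "\<beta> r T < \<epsilon>" "0 \<le> T"
    using eventually_happens'[OF trivial_limit_at_top_linorder] by blast
  then show ?thesis by (intro exI[of _ T]) auto
qed

text \<open>The additional element \<open>0\<close> keeps the supremum meaningful for the empty set and nonnegative if all
  elements of the set are negative.\<close>
definition nonneg_Sup :: "real set \<Rightarrow> real" where
  "nonneg_Sup V = Sup (insert 0 V)"

lemma nonneg_Sup_upper: "bdd_above V \<Longrightarrow> v \<in> V \<Longrightarrow> v \<le> nonneg_Sup V"
  unfolding nonneg_Sup_def by (intro cSup_upper) auto

lemma nonneg_Sup_ge_0: "bdd_above V \<Longrightarrow> 0 \<le> nonneg_Sup V"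
  unfolding nonneg_Sup_def by (intro cSup_upper) auto

lemma nonneg_Sup_least: "(\<And>v. v \<in> V \<Longrightarrow> v \<le> B) \<Longrightarrow> 0 \<le> B \<Longrightarrow> nonneg_Sup V \<le> B"
  unfolding nonneg_Sup_def by (intro cSup_least) auto

lemma nonneg_Sup_mono: "bdd_above W \<Longrightarrow> V \<subseteq> W \<Longrightarrow> nonneg_Sup V \<le> nonneg_Sup W"
  unfolding nonneg_Sup_def by (intro cSup_subset_mono) auto

text \<open>Here \<open>R p e v\<close> stands for: some trajectory with initial size \<open>p\<close> and input energy \<open>e\<close> reaches the size
  \<open>v\<close>. The supremum of \<open>v\<close> over all \<open>p, e \<le> r\<close> is finite, nondecreasing in \<open>r\<close> and tends to \<open>0\<close> with \<open>r\<close>,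
  hence has a majorant \<open>a\<close> of class \<open>K\<^sub>\<infinity>\<close>; taking \<open>r = max p e\<close> gives \<open>v \<le> a (max p e) \<le> a p + a e\<close>.\<close>
lemma class_Kinf_sum_bound:
  fixes R :: "real \<Rightarrow> real \<Rightarrow> real \<Rightarrow> bool"
  assumes nonneg: "\<And>p e v. R p e v \<Longrightarrow> 0 \<le> p \<and> 0 \<le> e"
    and bounded: "\<And>r. 0 \<le> r \<Longrightarrow> \<exists>B. \<forall>p e v. R p e v \<and> p \<le> r \<and> e \<le> r \<longrightarrow> v \<le> B"
    and small: "\<And>\<epsilon>. 0 < \<epsilon> \<Longrightarrow> \<exists>\<delta>>0. \<forall>p e v. R p e v \<and> p \<le> \<delta> \<and> e \<le> \<delta> \<longrightarrow> v \<le> \<epsilon>"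
  shows "\<exists>a. class_Kinf a \<and> (\<forall>p e v. R p e v \<longrightarrow> v \<le> a p + a e)"
proof -
  define V where "V r = {v. \<exists>p e. R p e v \<and> p \<le> r \<and> e \<le> r}" for r
  define g where "g r = nonneg_Sup (V r)" for r
  have bdd: "bdd_above (V r)" if "0 \<le> r" for r
    using bounded[OF that] by (auto simp: V_def bdd_above_def)
  have g_nonneg: "0 \<le> g r" if "0 \<le> r" for r
    using nonneg_Sup_ge_0 bdd[OF that] by (simp add: g_def)
  have mono: "mono_on {0..} g"
    by (intro mono_onI) (auto simp: g_def V_def intro!: nonneg_Sup_mono bdd[unfolded V_def] intro: order_trans)
  have g_small: "\<exists>\<delta>>0. \<forall>r. 0 \<le> r \<and> r \<le> \<delta> \<longrightarrow> g r \<le> \<epsilon>" if \<epsilon>: "0 < \<epsilon>" for \<epsilon>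
  proof -
    obtain \<delta> where "\<delta> > 0" and \<delta>: "\<And>p e v. R p e v \<Longrightarrow> p \<le> \<delta> \<Longrightarrow> e \<le> \<delta> \<Longrightarrow> v \<le> \<epsilon>"
      using small[OF \<epsilon>] by blast
    have "g r \<le> \<epsilon>" if "r \<le> \<delta>" for r
      unfolding g_def using \<epsilon> \<delta> that by (intro nonneg_Sup_least) (auto simp: V_def intro: order_trans)
    then show ?thesis using \<open>\<delta> > 0\<close> by blast
  qed
  define a where "a r = doubling_average g r + 1 * r" for r
  have K: "class_K a"
    unfolding a_def by (rule class_K_doubling_average[OF mono g_nonneg g_small]) auto
  have g_le: "g r \<le> a r" if "0 \<le> r" for r
    using le_doubling_average[OF mono that] that by (simp add: a_def)
  have "r \<le> a r" if "0 \<le> r" for r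
    using g_nonneg[OF that] le_doubling_average[OF mono that] by (simp add: a_def)
  then have "class_Kinf a"
    by (rule class_KinfI[OF K class_Kinf_id])
  moreover have "v \<le> a p + a e" if R: "R p e v" for p e v
  proof -
    have pe: "0 \<le> p" "0 \<le> e" using nonneg[OF R] by auto
    have "v \<le> g (max p e)"
      unfolding g_def using R pe by (intro nonneg_Sup_upper bdd) (use max.cobounded1 max.cobounded2 in \<open>force simp: V_def\<close>)+
    also have "\<dots> \<le> a (max p e)" using pe by (intro g_le) auto
    also have "\<dots> \<le> a p + a e"
      using class_K_nonneg[OF K] pe by (auto simp: max_def)
    finally show ?thesis .
  qed
  ultimately show ?thesis by blast
qed

text \<open>Now \<open>R p e t v\<close> also records the elapsed time \<open>t\<close>. If \<open>e > p\<close>, then \<open>a p + a e \<le> 2 a e\<close> bounds \<open>v\<close> without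
  any decay. Otherwise both \<open>p\<close> and \<open>e\<close> are at most \<open>r = p\<close>, and the supremum of \<open>v - a e\<close> over all
  such trajectories and all times from \<open>t\<close> on is at most \<open>a r\<close>, monotone in \<open>r\<close> and \<open>t\<close>, and tends to \<open>0\<close>
  for \<open>t \<rightarrow> \<infinity>\<close>. Averaging it in \<open>r\<close> gives a function of class KL; the factor \<open>exp (- t)\<close> makes the
  linear term that enforces strict monotonicity decay as well.\<close>
lemma class_KL_sum_bound:
  fixes R :: "real \<Rightarrow> real \<Rightarrow> real \<Rightarrow> real \<Rightarrow> bool"
  assumes nonneg: "\<And>p e t v. R p e t v \<Longrightarrow> 0 \<le> p \<and> 0 \<le> e \<and> 0 \<le> t"
    and a: "class_Kinf a"
    and bounded: "\<And>p e t v. R p e t v \<Longrightarrow> v \<le> a p + a e"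
    and attractive: "\<And>r \<epsilon>. 0 < r \<Longrightarrow> 0 < \<epsilon> \<Longrightarrow>
      \<exists>T\<ge>0. \<forall>p e t v. R p e t v \<and> p \<le> r \<and> e \<le> r \<and> T \<le> t \<longrightarrow> v \<le> \<epsilon> + a e"
  shows "\<exists>\<beta> \<rho>. class_KL \<beta> \<and> class_Kinf \<rho> \<and> (\<forall>p e t v. R p e t v \<longrightarrow> v \<le> \<beta> p t + \<rho> e)"
proof -
  have aK: "class_K a" using a by (simp add: class_Kinf_def)
  define V where "V r t = {v - a e | p e s v. R p e s v \<and> p \<le> r \<and> e \<le> r \<and> t \<le> s}" for r t
  define g where "g t r = nonneg_Sup (V r t)" for r t
  have V_le: "w \<le> a r" if "w \<in> V r t" for r t w
  proof -
    from that obtain p e s v where w: "w = v - a e" and R: "R p e s v" and "p \<le> r"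
      by (auto simp: V_def)
    have "w \<le> a p" using bounded[OF R] w by simp
    also have "\<dots> \<le> a r" using class_K_mono[OF aK] nonneg[OF R] \<open>p \<le> r\<close> by auto
    finally show ?thesis .
  qed
  then have bdd: "bdd_above (V r t)" for r t
    by (auto simp: bdd_above_def)
  have g_nonneg: "0 \<le> g t r" for r t
    unfolding g_def by (intro nonneg_Sup_ge_0 bdd)
  have g_le: "g t r \<le> a r" if "0 \<le> r" for r t
    unfolding g_def using V_le class_K_nonneg[OF aK that] by (intro nonneg_Sup_least) auto
  have mono: "mono_on {0..} (g t)" for t
    unfolding g_def by (intro mono_onI nonneg_Sup_mono bdd) (fastforce simp: V_def)
  have anti: "g t' r \<le> g t r" if "t \<le> t'" for r t t'
    unfolding g_def using that by (intro nonneg_Sup_mono bdd) (fastforce simp: V_def)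
  have small: "\<exists>\<delta>>0. \<forall>r. 0 \<le> r \<and> r \<le> \<delta> \<longrightarrow> g t r \<le> \<epsilon>" if "0 < \<epsilon>" for t \<epsilon>
    using class_K_small[OF aK that] g_le by (meson order_trans)
  define \<beta> where "\<beta> r t = doubling_average (g t) r + exp (- t) * r" for r t
  have "class_K (\<lambda>r. \<beta> r t)" for t
    unfolding \<beta>_def by (rule class_K_doubling_average[OF mono g_nonneg small]) auto
  moreover have "antimono_on {0..} (\<beta> r)" if r: "0 \<le> r" for r
    unfolding \<beta>_def using r
    by (intro monotone_onI add_mono doubling_average_mono_fun mono anti mult_right_mono) auto
  moreover have "(\<beta> r \<longlongrightarrow> 0) at_top" if r: "0 \<le> r" for r
  proof -
    have lim: "((\<lambda>t. g t (2 * r)) \<longlongrightarrow> 0) at_top"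
    proof (rule order_tendstoI)
      fix \<epsilon> :: real assume "0 < \<epsilon>"
      obtain T where "0 \<le> T" and T: "\<And>p e t v. R p e t v \<Longrightarrow> p \<le> 2 * r + 1 \<Longrightarrow> e \<le> 2 * r + 1 \<Longrightarrow> T \<le> t \<Longrightarrow> v \<le> \<epsilon> / 2 + a e"
        using attractive[of "2 * r + 1" "\<epsilon> / 2"] r \<open>0 < \<epsilon>\<close> by auto
      have "w \<le> \<epsilon> / 2" if "w \<in> V (2 * r) T" for w
      proof -
        from that obtain p e s v where "w = v - a e" "R p e s v" "p \<le> 2 * r" "e \<le> 2 * r" "T \<le> s"
          by (auto simp: V_def)
        then show ?thesis using T[of p e s v] by auto
      qed
      then have "g T (2 * r) \<le> \<epsilon> / 2"
        unfolding g_def using \<open>0 < \<epsilon>\<close> by (intro nonneg_Sup_least) auto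
      then have "g t (2 * r) < \<epsilon>" if "T \<le> t" for t
        using anti[OF that, of "2 * r"] \<open>0 < \<epsilon>\<close> by linarith
      then show "eventually (\<lambda>t. g t (2 * r) < \<epsilon>) at_top"
        using eventually_at_top_linorder by blast
    qed (use g_nonneg in \<open>auto intro!: always_eventually intro: less_le_trans\<close>)
    have "((\<lambda>t::real. exp (- t)) \<longlongrightarrow> 0) at_top"
      by (intro filterlim_compose[OF exp_at_bot] filterlim_uminus_at_bot_at_top)
    then have "((\<lambda>t. g t (2 * r) + exp (- t) * r) \<longlongrightarrow> 0) at_top"
      using tendsto_add[OF lim tendsto_mult_left_zero] by simp
    then show ?thesis
    proof (rule tendsto_sandwich[rotated 3])
      show "\<forall>\<^sub>F t in at_top. \<beta> r t \<le> g t (2 * r) + exp (- t) * r"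
        using doubling_average_le[OF mono r] by (simp add: \<beta>_def)
      show "\<forall>\<^sub>F t in at_top. 0 \<le> \<beta> r t"
        using order_trans[OF g_nonneg le_doubling_average[OF mono r]] r by (simp add: \<beta>_def)
    qed simp
  qed
  ultimately have "class_KL \<beta>" by (simp add: class_KL_def)
  define \<rho> where "\<rho> r = a r + a r" for r
  have "class_Kinf \<rho>"
    unfolding \<rho>_def by (rule class_KinfI[OF class_K_add[OF aK aK] a]) (use class_K_nonneg[OF aK] in auto)
  moreover have "v \<le> \<beta> p t + \<rho> e" if R: "R p e t v" for p e t v
  proof -
    have pe: "0 \<le> p" "0 \<le> e" using nonneg[OF R] by auto
    have g_\<beta>: "g t p \<le> \<beta> p t"
      using le_doubling_average[OF mono pe(1)] pe(1) by (simp add: \<beta>_def add_increasing2)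
    show ?thesis
    proof (cases "e \<le> p")
      case True
      have "v - a e \<le> g t p"
        unfolding g_def using R True by (intro nonneg_Sup_upper bdd) (auto simp: V_def)
      then show ?thesis using g_\<beta> class_K_nonneg[OF aK pe(2)] by (simp add: \<rho>_def)
    next
      case False
      then have "v \<le> \<rho> e"
        using bounded[OF R] class_K_mono[OF aK pe(1), of e] by (simp add: \<rho>_def)
      then show ?thesis using g_\<beta> g_nonneg[of t p] by linarith
    qed
  qed
  ultimately show ?thesis using \<open>class_KL \<beta>\<close> by blast
qed

section \<open>Histories, input energy and global solutions\<close>

lemma hist_space_iff:
  "\<psi> \<in> hist_space \<tau> \<longleftrightarrow> continuous_on {-\<tau>..0} \<psi> \<and> \<psi> \<in> extensional {-\<tau>..0}"
proof -
  have "bounded (\<psi> ` {-\<tau>..0})" if "continuous_on {-\<tau>..0} \<psi>"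
    using that compact_continuous_image compact_imp_bounded by blast
  then show ?thesis
    by (auto simp: hist_space_def hist_metric_def Metric_space.fspace_def)
qed

lemma norm_le_sup_norm:
  assumes "\<psi> \<in> hist_space \<tau>" "s \<in> {-\<tau>..0}"
  shows "norm (\<psi> s) \<le> sup_norm \<tau> \<psi>"
proof -
  have "compact ((\<lambda>s. norm (\<psi> s)) ` {-\<tau>..0})"
    using assms by (intro compact_continuous_image continuous_intros) (auto simp: hist_space_iff)
  then show ?thesis
    unfolding sup_norm_def using assms
    by (intro cSUP_upper bounded_imp_bdd_above compact_imp_bounded)
qed

lemma sup_norm_le: "0 \<le> \<tau> \<Longrightarrow> (\<And>s. s \<in> {-\<tau>..0} \<Longrightarrow> norm (\<psi> s) \<le> B) \<Longrightarrow> sup_norm \<tau> \<psi> \<le> B"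
  unfolding sup_norm_def by (intro cSUP_least) auto

lemma sup_norm_nonneg: "0 \<le> \<tau> \<Longrightarrow> \<psi> \<in> hist_space \<tau> \<Longrightarrow> 0 \<le> sup_norm \<tau> \<psi>"
  by (rule order_trans[OF norm_ge_zero norm_le_sup_norm[of \<psi> \<tau> 0]]) auto

lemma history_apply [simp]: "s \<in> {-\<tau>..0} \<Longrightarrow> history \<tau> x t s = x (t + s)"
  by (simp add: history_def)

lemma history_in_hist_space: "continuous_on {t - \<tau>..t} x \<Longrightarrow> history \<tau> x t \<in> hist_space \<tau>"
  unfolding hist_space_iff
proof
  assume "continuous_on {t - \<tau>..t} x"
  then have "continuous_on {-\<tau>..0} (\<lambda>s. x (t + s))"
    by (rule continuous_on_compose2) (auto intro!: continuous_intros)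
  then show "continuous_on {-\<tau>..0} (history \<tau> x t)"
    by (rule continuous_on_eq) simp
qed (simp add: history_def)

lemma norm_le_sup_norm_history:
  assumes "continuous_on {t - \<tau>..t} x" "s \<in> {t - \<tau>..t}"
  shows "norm (x s) \<le> sup_norm \<tau> (history \<tau> x t)"
  using norm_le_sup_norm[OF history_in_hist_space[OF assms(1)], of "s - t"] assms(2) by simp

lemma sup_norm_history_le:
  assumes "0 \<le> \<tau>" "\<And>s. s \<in> {t - \<tau>..t} \<Longrightarrow> norm (x s) \<le> B"
  shows "sup_norm \<tau> (history \<tau> x t) \<le> B"
  using assms by (intro sup_norm_le) auto

definition energy :: "(real \<Rightarrow> real) \<Rightarrow> (real \<Rightarrow> real ^ 'm) \<Rightarrow> real \<Rightarrow> real \<Rightarrow> real" where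
  "energy \<kappa> u a b = enn2real (input_energy \<kappa> (truncate_input u a b))"

lemma energy_nonneg: "0 \<le> energy \<kappa> u a b"
  by (simp add: energy_def)

text \<open>For an admissible input the energy is an ordinary finite integral, which gives access to
  additivity and comparison of integrals.\<close>
lemma energy_has_integral:
  fixes u :: "real \<Rightarrow> real ^ 'm"
  assumes \<kappa>: "class_K \<kappa>" and u: "u \<in> inputs" and ab: "0 \<le> a" "a \<le> b"
  shows "((\<lambda>s. \<kappa> (norm (u s))) has_integral energy \<kappa> u a b) {a..b}"
proof -
  let ?g = "\<lambda>s. \<kappa> (norm (u s))"
  have nonneg: "0 \<le> ?g s" for s
    by (rule class_K_nonneg[OF \<kappa>]) simp
  have "u \<in> borel_measurable (lebesgue_on {0..})"
    using u by (simp add: inputs_def)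
  then have u_meas: "u \<in> borel_measurable (lebesgue_on {a..b})"
    by (rule measurable_restrict_mono) (use ab in auto)
  have "continuous_on UNIV (\<lambda>r. \<kappa> (max 0 r))"
    using \<kappa> by (auto simp: class_K_def intro!: continuous_on_compose2[of "{0..}" \<kappa>] continuous_intros)
  then have "(\<lambda>r. \<kappa> (max 0 r)) \<in> borel_measurable borel"
    by (rule borel_measurable_continuous_onI)
  then have "(\<lambda>s. \<kappa> (max 0 (norm (u s)))) \<in> borel_measurable (lebesgue_on {a..b})"
    using u_meas by measurable
  then have g_meas: "?g \<in> borel_measurable (lebesgue_on {a..b})" by simp
  obtain B where B: "\<And>s. s \<in> {0..b} \<Longrightarrow> norm (u s) \<le> B"
  proof -
    have "bounded (u ` {0..b})" using u ab by (auto simp: inputs_def)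
    then obtain B where "\<forall>y \<in> u ` {0..b}. norm y \<le> B" unfolding bounded_iff by blast
    then show thesis by (intro that[of B]) auto
  qed
  have "?g integrable_on {a..b}"
  proof (rule measurable_bounded_by_integrable_imp_integrable[OF g_meas integrable_const_ivl[of "\<kappa> B"]])
    fix s assume "s \<in> {a..b}"
    then show "norm (?g s) \<le> \<kappa> B"
      using nonneg B[of s] ab class_K_mono[OF \<kappa>, of "norm (u s)" B] by auto
  qed auto
  then have I: "(?g has_integral (integral {a..b} ?g)) {a..b}" by blast
  have "input_energy \<kappa> (truncate_input u a b) = (\<integral>\<^sup>+s. ennreal (?g s) * indicator {a..b} s \<partial>lebesgue)"
    unfolding input_energy_def
  proof (rule nn_integral_cong_AE)
    \<comment> \<open>The truncated input lives on the half-open interval, so the integrands may differ at \<open>a\<close>.\<close>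
    have "AE s in lebesgue. s \<noteq> a"
      using AE_not_in[of "{a}" lebesgue] by (simp add: negligible_iff_null_sets[symmetric])
    then show "AE s in lebesgue. ennreal (\<kappa> (norm (truncate_input u a b s))) * indicator {0..} s
        = ennreal (?g s) * indicator {a..b} s"
      by eventually_elim
        (use \<kappa> ab in \<open>auto simp: truncate_input_def indicator_def class_K_def\<close>)
  qed
  also have "\<dots> = ennreal (integral {a..b} ?g)"
    unfolding nn_integral_completion by (rule nn_integral_has_integral_lebesgue'[OF nonneg I])
  finally have "energy \<kappa> u a b = integral {a..b} ?g"
    using Henstock_Kurzweil_Integration.integral_nonneg[OF has_integral_integrable[OF I] nonneg]
    by (simp add: energy_def)
  then show ?thesis using I by simp
qed

lemma energy_combine:
  fixes u :: "real \<Rightarrow> real ^ 'm"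
  assumes "class_K \<kappa>" "u \<in> inputs" "0 \<le> a" "a \<le> b" "b \<le> c"
  shows "energy \<kappa> u a c = energy \<kappa> u a b + energy \<kappa> u b c"
proof -
  have "0 \<le> b" "a \<le> c" using assms by auto
  then have "((\<lambda>s. \<kappa> (norm (u s))) has_integral (energy \<kappa> u a b + energy \<kappa> u b c)) {a..c}"
    using assms by (intro has_integral_combine[of a b c] energy_has_integral) auto
  then show ?thesis
    using has_integral_unique[OF energy_has_integral[OF assms(1-3) \<open>a \<le> c\<close>]] by blast
qed

lemma energy_mono:
  fixes u :: "real \<Rightarrow> real ^ 'm"
  assumes "class_K \<kappa>" "u \<in> inputs" "0 \<le> a" "a \<le> a'" "a' \<le> b'" "b' \<le> b"
  shows "energy \<kappa> u a' b' \<le> energy \<kappa> u a b"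
  using energy_combine[OF assms(1-4), of b] energy_combine[OF assms(1,2), of a' b' b] assms
    energy_nonneg[of \<kappa> u a a'] energy_nonneg[of \<kappa> u b' b] by simp

lemma energy_mono_gain:
  fixes u :: "real \<Rightarrow> real ^ 'm"
  assumes "class_K \<alpha>" "class_K \<kappa>" "u \<in> inputs" "0 \<le> a" "a \<le> b" "\<And>r. 0 \<le> r \<Longrightarrow> \<alpha> r \<le> \<kappa> r"
  shows "energy \<alpha> u a b \<le> energy \<kappa> u a b"
  using assms by (intro has_integral_le[OF energy_has_integral energy_has_integral]) auto

lemma energy_zero: "class_K \<kappa> \<Longrightarrow> energy \<kappa> (\<lambda>_. 0) a b = 0"
  by (simp add: energy_def input_energy_def truncate_input_def class_K_def)

lemma zero_in_inputs: "(\<lambda>_. 0 :: real ^ 'a) \<in> inputs"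
proof -
  have "bounded ((\<lambda>_. 0 :: real ^ 'a) ` {0..T})" for T :: real
    by (rule bounded_subset[of "{0}"]) auto
  then show ?thesis by (simp add: inputs_def)
qed

text \<open>A solution on the whole half-line starting at \<open>t0\<close>. Its initial state is read off from \<open>x\<close>, so that
  restarting at a later time leaves \<open>x\<close> and \<open>u\<close> unchanged (\<open>global_solution_restart\<close>).\<close>
definition global_solution ::
  "real \<Rightarrow> ('n::finite, 'm::finite) rhs \<Rightarrow> real \<Rightarrow> (real \<Rightarrow> real ^ 'm) \<Rightarrow> (real \<Rightarrow> real ^ 'n) \<Rightarrow> bool" where
  "global_solution \<tau> f t0 u x \<longleftrightarrow> is_solution \<tau> f t0 (history \<tau> x t0) u \<infinity> x"

lemma global_solution_alt:
  "global_solution \<tau> f t0 u x \<longleftrightarrow>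
     continuous_on {t0 - \<tau>..} x \<and>
     (\<forall>b\<ge>t0. abs_continuous_on {t0..b} x) \<and>
     (AE t in lebesgue. t0 < t \<longrightarrow> (x has_vector_derivative f t (history \<tau> x t) (u t)) (at t))"
proof -
  have "sol_dom \<tau> t0 \<infinity> = {t0 - \<tau>..}" by (auto simp: sol_dom_def)
  then show ?thesis by (simp add: global_solution_def is_solution_def)
qed

lemma global_solution_restart:
  assumes "global_solution \<tau> f t0 u x" "t0 \<le> s"
  shows "global_solution \<tau> f s u x"
proof -
  have cont: "continuous_on {t0 - \<tau>..} x" and ac: "\<forall>b\<ge>t0. abs_continuous_on {t0..b} x"
    and ode: "AE t in lebesgue. t0 < t \<longrightarrow> (x has_vector_derivative f t (history \<tau> x t) (u t)) (at t)"
    using assms(1) unfolding global_solution_alt by blast+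
  have "continuous_on {s - \<tau>..} x"
    using cont by (rule continuous_on_subset) (use assms(2) in auto)
  moreover have "abs_continuous_on {s..b} x" if "s \<le> b" for b
    by (rule abs_continuous_on_subset[of "{t0..b}"]) (use ac assms(2) that in auto)
  moreover have "AE t in lebesgue. s < t \<longrightarrow> (x has_vector_derivative f t (history \<tau> x t) (u t)) (at t)"
    using ode by eventually_elim (use assms(2) in simp)
  ultimately show ?thesis
    unfolding global_solution_alt by blast
qed

lemma global_solution_is_max_solution:
  "global_solution \<tau> f t0 u x \<Longrightarrow> is_max_solution \<tau> f t0 (history \<tau> x t0) u \<infinity> x"
  by (simp add: global_solution_def is_max_solution_def)

lemma is_max_solution_global_solution:
  assumes "is_max_solution \<tau> f t0 \<psi> u \<infinity> x"
  shows "global_solution \<tau> f t0 u x" "history \<tau> x t0 = \<psi>"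
  using assms by (auto simp: global_solution_def is_max_solution_def is_solution_def)

lemma global_solution_continuous_on: "global_solution \<tau> f t0 u x \<Longrightarrow> t0 - \<tau> \<le> a \<Longrightarrow> continuous_on {a..b} x"
  unfolding global_solution_alt by (auto elim: continuous_on_subset)

lemma global_solution_history:
  "global_solution \<tau> f t0 u x \<Longrightarrow> t0 \<le> t \<Longrightarrow> history \<tau> x t \<in> hist_space \<tau>"
  by (rule history_in_hist_space[OF global_solution_continuous_on[of \<tau> f t0 u x]]) auto

section \<open>Deviation from the unforced solution\<close>

text \<open>For \<open>norm \<mu> \<le> \<delta>\<close>, with the \<open>\<delta>\<close> that (R2) assigns to \<open>r\<close> and \<open>\<epsilon>\<close>, the difference is below \<open>\<epsilon>\<close>. For
  \<open>norm \<mu> > \<delta>\<close> the crude bound \<open>N r (2 + \<gamma> (norm \<mu>))\<close> from (R1) suffices, because then the constant \<open>2\<close>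
  is at most \<open>(2 / \<kappa> \<delta>) \<kappa> (norm \<mu>)\<close>.\<close>
lemma input_effect_bound:
  fixes f :: "('n::finite, 'm::finite) rhs"
  assumes \<tau>: "0 \<le> \<tau>" and R1: "cond_R1 \<tau> f \<gamma>" and R2: "cond_R2 \<tau> f"
    and \<kappa>: "class_K \<kappa>" and \<gamma>\<kappa>: "\<forall>s\<ge>0. \<gamma> s \<le> \<kappa> s"
    and r: "0 < r" and \<epsilon>: "0 < \<epsilon>"
  shows "\<exists>K\<ge>0. \<forall>t\<ge>0. \<forall>\<psi>\<in>hist_space \<tau>. \<forall>\<mu>. sup_norm \<tau> \<psi> \<le> r \<longrightarrow>
    norm (f t \<psi> \<mu> - f t \<psi> 0) \<le> \<epsilon> + K * \<kappa> (norm \<mu>)"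
proof -
  obtain N where N: "mono_on {0..} N" "\<And>r. 0 \<le> r \<Longrightarrow> 0 < N r"
    and f_le: "\<And>t \<psi> \<mu>. 0 \<le> t \<Longrightarrow> \<psi> \<in> hist_space \<tau> \<Longrightarrow>
      norm (f t \<psi> \<mu>) \<le> N (sup_norm \<tau> \<psi>) * (1 + \<gamma> (norm \<mu>))"
    using R1 unfolding cond_R1_def by blast
  have \<gamma>: "class_K \<gamma>" using R1 by (simp add: cond_R1_def class_Kinf_def)
  obtain \<delta> where "\<delta> > 0" and \<delta>: "\<And>t \<psi> \<mu>. 0 \<le> t \<Longrightarrow> \<psi> \<in> hist_space \<tau> \<Longrightarrow> sup_norm \<tau> \<psi> \<le> r \<Longrightarrow>
      norm \<mu> \<le> \<delta> \<Longrightarrow> norm (f t \<psi> \<mu> - f t \<psi> 0) < \<epsilon>"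
    using R2[unfolded cond_R2_def, THEN spec, THEN mp, OF r, THEN spec, THEN mp, OF \<epsilon>] by blast
  have \<kappa>\<delta>: "0 < \<kappa> \<delta>" using class_K_pos[OF \<kappa> \<open>\<delta> > 0\<close>] .
  define K where "K = N r * (2 / \<kappa> \<delta> + 1)"
  have K: "0 \<le> K" using N(2)[of r] r \<kappa>\<delta> by (simp add: K_def)
  have "norm (f t \<psi> \<mu> - f t \<psi> 0) \<le> \<epsilon> + K * \<kappa> (norm \<mu>)"
    if t: "0 \<le> t" and \<psi>: "\<psi> \<in> hist_space \<tau>" "sup_norm \<tau> \<psi> \<le> r" for t \<psi> \<mu>
  proof (cases "norm \<mu> \<le> \<delta>")
    case True
    then show ?thesis
      using \<delta>[OF t \<psi> True] K class_K_nonneg[OF \<kappa>, of "norm \<mu>"]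
      by (smt (verit) mult_nonneg_nonneg norm_ge_zero)
  next
    case False
    then have big: "\<kappa> \<delta> \<le> \<kappa> (norm \<mu>)"
      using \<open>\<delta> > 0\<close> by (intro class_K_mono[OF \<kappa>]) auto
    have N_le: "N (sup_norm \<tau> \<psi>) \<le> N r"
      using sup_norm_nonneg[OF \<tau> \<psi>(1)] \<psi>(2) by (intro mono_onD[OF N(1)]) auto
    have "norm (f t \<psi> \<nu>) \<le> N r * (1 + \<gamma> (norm \<nu>))" for \<nu>
      using class_K_nonneg[OF \<gamma> norm_ge_zero, of \<nu>]
      by (intro order_trans[OF f_le[OF t \<psi>(1)] mult_right_mono[OF N_le]]) simp
    from this[of \<mu>] this[of 0]
    have "norm (f t \<psi> \<mu> - f t \<psi> 0) \<le> N r * (1 + \<gamma> (norm \<mu>)) + N r"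
      using norm_triangle_ineq4[of "f t \<psi> \<mu>" "f t \<psi> 0"] \<gamma> by (simp add: class_K_def)
    also have "\<dots> = N r * (2 + \<gamma> (norm \<mu>))" by (simp add: algebra_simps)
    also have "\<dots> \<le> N r * (2 / \<kappa> \<delta> * \<kappa> (norm \<mu>) + \<kappa> (norm \<mu>))"
    proof -
      have "2 / \<kappa> \<delta> * \<kappa> \<delta> \<le> 2 / \<kappa> \<delta> * \<kappa> (norm \<mu>)"
        using big \<kappa>\<delta> by (intro mult_left_mono) auto
      then show ?thesis
        using \<kappa>\<delta> \<gamma>\<kappa>[rule_format, OF norm_ge_zero, of \<mu>] N(2)[of r] r by (intro mult_left_mono add_mono) auto
    qed
    also have "\<dots> = K * \<kappa> (norm \<mu>)" by (simp add: K_def algebra_simps)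
    finally show ?thesis using \<epsilon> by simp
  qed
  then show ?thesis using K by blast
qed

text \<open>By (R3) and \<open>input_effect_bound\<close>, the difference of the two solutions grows at most at the rate
  \<open>\<epsilon> + K \<kappa> (norm (u t)) + L w\<close>, where \<open>w\<close> bounds the past of the difference. The Gronwall lemma turns
  this into a bound proportional to \<open>\<epsilon> T + K \<delta>\<close>, and \<open>\<epsilon>\<close> is chosen before \<open>K\<close>, which depends on it, and
  \<open>K\<close> before \<open>\<delta>\<close>. No constant depends on the initial time.\<close>
lemma deviation_from_unforced:
  fixes f :: "('n::finite, 'm::finite) rhs"
  assumes \<tau>: "0 \<le> \<tau>" and R1: "cond_R1 \<tau> f \<gamma>" and R2: "cond_R2 \<tau> f" and R3: "cond_R3 \<tau> f"
    and \<kappa>: "class_K \<kappa>" and \<gamma>\<kappa>: "\<forall>s\<ge>0. \<gamma> s \<le> \<kappa> s"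
    and r: "0 < r" and T: "0 < T" and \<eta>: "0 < \<eta>"
  shows "\<exists>\<delta>>0. \<forall>a b u x y. 0 \<le> a \<and> a \<le> b \<and> b \<le> a + T \<and> u \<in> inputs \<and>
    global_solution \<tau> f a u x \<and> global_solution \<tau> f a (\<lambda>_. 0) y \<and> history \<tau> x a = history \<tau> y a \<and>
    (\<forall>s\<in>{a - \<tau>..b}. norm (x s) \<le> r \<and> norm (y s) \<le> r) \<and> energy \<kappa> u a b \<le> \<delta> \<longrightarrow>
    norm (x b - y b) \<le> \<eta>"
proof -
  obtain L0 where L0: "\<forall>t\<ge>0. \<forall>\<psi>\<in>hist_space \<tau>. \<forall>\<phi>\<in>hist_space \<tau>.
      sup_norm \<tau> \<psi> \<le> r \<and> sup_norm \<tau> \<phi> \<le> r \<longrightarrow>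
      norm (f t \<psi> 0 - f t \<phi> 0) \<le> L0 * sup_norm \<tau> (\<lambda>s. \<psi> s - \<phi> s)"
    using R3[unfolded cond_R3_def, THEN spec, THEN mp, OF r] by (rule exE)
  define L where "L = max 1 L0"
  have L: "0 < L" "L0 \<le> L" by (auto simp: L_def)
  define C where "C = 2 * exp (2 * L * T)"
  have C: "0 < C" by (simp add: C_def)
  \<comment> \<open>\<open>C\<close> is the Gronwall factor for the longest window; \<open>\<epsilon>\<close> and \<open>\<delta>\<close> give each of the two terms of
    \<open>C (\<epsilon> T + (K + 1) \<delta>)\<close> the value \<open>\<eta> / 2\<close>. The factor \<open>K + 1\<close> avoids a case distinction for \<open>K = 0\<close>.\<close>
  define \<epsilon> where "\<epsilon> = \<eta> / (2 * C * T)"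
  have \<epsilon>: "0 < \<epsilon>" using \<eta> C T by (simp add: \<epsilon>_def)
  obtain K where K: "0 \<le> K" and fK: "\<And>t \<psi> \<mu>. 0 \<le> t \<Longrightarrow> \<psi> \<in> hist_space \<tau> \<Longrightarrow> sup_norm \<tau> \<psi> \<le> r \<Longrightarrow>
      norm (f t \<psi> \<mu> - f t \<psi> 0) \<le> \<epsilon> + K * \<kappa> (norm \<mu>)"
    using input_effect_bound[OF \<tau> R1 R2 \<kappa> \<gamma>\<kappa> r \<epsilon>] by blast
  define \<delta> where "\<delta> = \<eta> / (2 * C * (K + 1))"
  have \<delta>: "0 < \<delta>" using \<eta> C K by (simp add: \<delta>_def)
  have "norm (x b - y b) \<le> \<eta>"
    if a: "0 \<le> a" and ab: "a \<le> b" "b \<le> a + T" and u: "u \<in> inputs"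
      and x: "global_solution \<tau> f a u x" and y: "global_solution \<tau> f a (\<lambda>_. 0) y"
      and hist: "history \<tau> x a = history \<tau> y a"
      and xy_le: "\<forall>s\<in>{a - \<tau>..b}. norm (x s) \<le> r \<and> norm (y s) \<le> r"
      and en: "energy \<kappa> u a b \<le> \<delta>" for a b u x y
  proof -
    define z where "z t = x t - y t" for t
    define g where "g t = \<epsilon> + K * \<kappa> (norm (u t))" for t
    have xy_past: "x s = y s" if "s \<in> {a - \<tau>..a}" for s
      using fun_cong[OF hist, of "s - a"] that by simp
    have x_cont: "continuous_on {s..t} x" and y_cont: "continuous_on {s..t} y" if "a - \<tau> \<le> s" for s t
      using global_solution_continuous_on[OF _ that] x y by blast+
    have I: "(g has_integral (\<epsilon> * (b - a) + K * energy \<kappa> u a b)) {a..b}"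
      unfolding g_def using ab has_integral_const_real[of \<epsilon> a b]
      by (intro has_integral_add has_integral_mult_right energy_has_integral[OF \<kappa> u a ab(1)])
        (simp add: mult.commute)
    have "AE t in lebesgue. a < t \<longrightarrow> (x has_vector_derivative f t (history \<tau> x t) (u t)) (at t)"
      using x unfolding global_solution_alt by blast
    moreover have "AE t in lebesgue. a < t \<longrightarrow> (y has_vector_derivative f t (history \<tau> y t) 0) (at t)"
      using y unfolding global_solution_alt by blast
    ultimately have "AE t in lebesgue. a < t \<longrightarrow> (x has_vector_derivative f t (history \<tau> x t) (u t)) (at t) \<and>
        (y has_vector_derivative f t (history \<tau> y t) 0) (at t)"
      by eventually_elim auto
    then obtain N where N: "N \<in> null_sets lebesgue" and ode:
      "\<And>t. t \<notin> N \<Longrightarrow> a < t \<Longrightarrow> (x has_vector_derivative f t (history \<tau> x t) (u t)) (at t)"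
      "\<And>t. t \<notin> N \<Longrightarrow> a < t \<Longrightarrow> (y has_vector_derivative f t (history \<tau> y t) 0) (at t)"
      by (rule AE_E3) auto
    have M: "negligible (insert a N)"
      using N by (simp add: negligible_iff_null_sets)
    have z_le: "norm (z b) \<le> 2 * (\<epsilon> * (b - a) + K * energy \<kappa> u a b) * exp (2 * L * (b - a))"
    proof (rule delay_gronwall[OF ab(1) L(1) _ _ _ _ _ _ M])
      show "abs_continuous_on {a..b} z"
        unfolding z_def using x y ab(1) unfolding global_solution_alt
        by (intro abs_continuous_on_diff) blast+
      show "continuous_on {a..b} z"
        unfolding z_def using \<tau> by (intro continuous_on_diff x_cont y_cont) auto
      show "z a = 0" using xy_past[of a] \<tau> by (simp add: z_def)
      show "g integrable_on {a..b}" "integral {a..b} g \<le> \<epsilon> * (b - a) + K * energy \<kappa> u a b"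
        using I by (auto simp: integral_unique)
      show "0 \<le> g t" for t
        using \<epsilon> K class_K_nonneg[OF \<kappa>, of "norm (u t)"] by (simp add: g_def)
      fix t w assume t: "t \<in> {a..b} - insert a N" and w: "\<And>s. s \<in> {a..t} \<Longrightarrow> norm (z s) \<le> w"
      then have at: "a < t" "t \<le> b" "t \<notin> N" "0 \<le> t" using a by auto
      let ?v = "f t (history \<tau> x t) (u t) - f t (history \<tau> y t) 0"
      have "(z has_vector_derivative ?v) (at t)"
        unfolding z_def using ode[OF at(3,1)] by (rule has_vector_derivative_diff)
      then have deriv: "(z has_vector_derivative ?v) (at t within {a..b})"
        by (rule has_vector_derivative_at_within)
      have H: "history \<tau> x t \<in> hist_space \<tau>" "history \<tau> y t \<in> hist_space \<tau>"
        using global_solution_history x y at(1) by (meson less_imp_le)+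
      have S: "sup_norm \<tau> (history \<tau> x t) \<le> r" "sup_norm \<tau> (history \<tau> y t) \<le> r"
        using xy_le at by (auto intro!: sup_norm_history_le[OF \<tau>])
      \<comment> \<open>Before \<open>a\<close> the two solutions share their initial state, so the difference vanishes there.\<close>
      have "norm (z s) \<le> w" if "s \<in> {t - \<tau>..t}" for s
      proof (cases "s < a")
        case True
        then have "z s = 0" using xy_past[of s] that at by (simp add: z_def)
        then show ?thesis using order_trans[OF norm_ge_zero w[of a]] at by simp
      qed (use that w[of s] in auto)
      then have "sup_norm \<tau> (\<lambda>s. history \<tau> x t s - history \<tau> y t s) \<le> w"
        by (intro sup_norm_le[OF \<tau>]) (simp add: z_def)
      moreover have "0 \<le> sup_norm \<tau> (\<lambda>s. history \<tau> x t s - history \<tau> y t s)"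
      proof -
        have "continuous_on {-\<tau>..0} (\<lambda>s. norm (history \<tau> x t s - history \<tau> y t s))"
          using H unfolding hist_space_iff by (intro continuous_intros) auto
        then have "bdd_above ((\<lambda>s. norm (history \<tau> x t s - history \<tau> y t s)) ` {-\<tau>..0})"
          by (intro bounded_imp_bdd_above compact_imp_bounded compact_continuous_image) auto
        then show ?thesis
          unfolding sup_norm_def using \<tau> by (intro cSUP_upper2[of _ _ 0]) auto
      qed
      ultimately have "L0 * sup_norm \<tau> (\<lambda>s. history \<tau> x t s - history \<tau> y t s) \<le> L * w"
        using L by (intro mult_mono) auto
      then have "norm (f t (history \<tau> x t) 0 - f t (history \<tau> y t) 0) \<le> L * w"
        using L0[rule_format, OF at(4) H conjI[OF S]] by linarith
      moreover have "norm (f t (history \<tau> x t) (u t) - f t (history \<tau> x t) 0) \<le> g t"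
        unfolding g_def by (rule fK[OF at(4) H(1) S(1)])
      moreover have "norm ?v \<le> norm (f t (history \<tau> x t) (u t) - f t (history \<tau> x t) 0)
          + norm (f t (history \<tau> x t) 0 - f t (history \<tau> y t) 0)"
        by norm
      ultimately have "norm ?v \<le> g t + L * w" by linarith
      then show "\<exists>v. (z has_vector_derivative v) (at t within {a..b}) \<and> norm v \<le> g t + L * w"
        using deriv by blast
    qed
    have "norm (z b) \<le> 2 * (\<epsilon> * T + (K + 1) * \<delta>) * exp (2 * L * T)"
    proof (rule order_trans[OF z_le], intro mult_mono add_mono)
      show "exp (2 * L * (b - a)) \<le> exp (2 * L * T)"
        using ab L by simp
    qed (use \<epsilon> K \<delta> T ab en energy_nonneg[of \<kappa> u a b] in auto)
    also have "\<dots> = C * (\<epsilon> * T) + C * ((K + 1) * \<delta>)" by (simp add: C_def algebra_simps)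
    also have "C * (\<epsilon> * T) = \<eta> / 2" using C T by (simp add: \<epsilon>_def)
    also have "C * ((K + 1) * \<delta>) = \<eta> / 2"
    proof -
      have "C * (k * (\<eta> / (2 * C * k))) = \<eta> / 2" if "0 < k" for k using C that by simp
      then show ?thesis unfolding \<delta>_def using K by (meson add_nonneg_pos zero_less_one)
    qed
    finally show ?thesis by (simp add: z_def)
  qed
  then show ?thesis using \<delta> by blast
qed

section \<open>The integral input-to-state estimate\<close>

text \<open>The setting of the nontrivial implication, with witnesses of the stability properties: \<open>\<beta>\<close> from
  0-GUAS and \<open>\<alpha>\<close>, \<open>\<rho>\<close>, \<open>c\<close> from UBEBS. The gain \<open>\<kappa>\<close> measures all energies; it only has to dominate \<open>\<gamma>\<close>,
  and it carries the UBEBS estimate because enlarging the gain enlarges the energy.\<close>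
locale stable_delay_system =
  fixes \<tau> :: real and f :: "('n::finite, 'm::finite) rhs" and \<gamma> \<kappa> \<alpha> \<rho> :: "real \<Rightarrow> real"
    and \<beta> :: "real \<Rightarrow> real \<Rightarrow> real" and c :: real
  assumes system: "time_delay_system \<tau> f"
    and R1: "cond_R1 \<tau> f \<gamma>" and R2: "cond_R2 \<tau> f" and R3: "cond_R3 \<tau> f"
    and \<kappa>: "class_K \<kappa>" and \<gamma>_le_\<kappa>: "\<forall>s\<ge>0. \<gamma> s \<le> \<kappa> s"
    and \<beta>: "class_KL \<beta>"
    and unforced_stable: "\<And>t0 \<psi> T x t. 0 \<le> t0 \<Longrightarrow> \<psi> \<in> hist_space \<tau> \<Longrightarrow>
      is_max_solution \<tau> f t0 \<psi> (\<lambda>_. 0) T x \<Longrightarrow>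
      T = \<infinity> \<and> (\<forall>t\<ge>t0. norm (x t) \<le> \<beta> (sup_norm \<tau> \<psi>) (t - t0))"
    and \<alpha>: "class_K \<alpha>" and \<rho>: "class_K \<rho>" and c: "0 \<le> c"
    and energy_bounded: "\<And>t0 u x t. 0 \<le> t0 \<Longrightarrow> u \<in> inputs \<Longrightarrow> global_solution \<tau> f t0 u x \<Longrightarrow> t0 \<le> t \<Longrightarrow>
      norm (x t) \<le> \<alpha> (sup_norm \<tau> (history \<tau> x t0)) + \<rho> (energy \<kappa> u t0 t) + c"
begin

lemma \<tau>: "0 \<le> \<tau>"
  using system by (simp add: time_delay_system_def)

lemma unforced_solution_exists:
  assumes "0 \<le> t0" "\<psi> \<in> hist_space \<tau>"
  shows "\<exists>y. global_solution \<tau> f t0 (\<lambda>_. 0) y \<and> history \<tau> y t0 = \<psi> \<and>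
    (\<forall>t\<ge>t0. norm (y t) \<le> \<beta> (sup_norm \<tau> \<psi>) (t - t0))"
proof -
  have "\<forall>t0\<ge>0. \<forall>\<psi>\<in>hist_space \<tau>. \<forall>u\<in>inputs. \<exists>T x. is_max_solution \<tau> f t0 \<psi> u T x"
    using system unfolding time_delay_system_def by blast
  then obtain T y where y: "is_max_solution \<tau> f t0 \<psi> (\<lambda>_. 0) T y"
    using assms zero_in_inputs by blast
  have "T = \<infinity>" "\<forall>t\<ge>t0. norm (y t) \<le> \<beta> (sup_norm \<tau> \<psi>) (t - t0)"
    using unforced_stable[OF assms y] by auto
  then show ?thesis
    using is_max_solution_global_solution y by blast
qed

text \<open>The unforced solution starting in the state of \<open>x\<close> at time \<open>a\<close> exists for all times by 0-GUAS, and
  its size stays below \<open>\<beta> r 0\<close>. So both solutions lie in a common ball, in which the deviation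
  estimate applies. The length of the window is arbitrary up to \<open>T\<close>; only the energy up to the
  time \<open>b\<close> of the estimate enters.\<close>
lemma near_unforced:
  assumes r: "0 < r" and T: "0 < T" and \<eta>: "0 < \<eta>"
  shows "\<exists>\<delta>>0. \<forall>a b u x. 0 \<le> a \<and> a \<le> b \<and> b \<le> a + T \<and> u \<in> inputs \<and> global_solution \<tau> f a u x \<and>
    (\<forall>s\<in>{a - \<tau>..b}. norm (x s) \<le> r) \<and> energy \<kappa> u a b \<le> \<delta> \<longrightarrow>
    norm (x b) \<le> \<beta> (sup_norm \<tau> (history \<tau> x a)) (b - a) + \<eta>"
proof -
  define r' where "r' = r + \<beta> r 0"
  have \<beta>0: "0 \<le> \<beta> r 0" using class_K_nonneg[OF class_KL_K[OF \<beta>]] r by simp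
  then have r': "0 < r'" "r \<le> r'" using r by (auto simp: r'_def)
  obtain \<delta> where "\<delta> > 0" and \<delta>: "\<forall>a b u x y. 0 \<le> a \<and> a \<le> b \<and> b \<le> a + T \<and> u \<in> inputs \<and>
      global_solution \<tau> f a u x \<and> global_solution \<tau> f a (\<lambda>_. 0) y \<and> history \<tau> x a = history \<tau> y a \<and>
      (\<forall>s\<in>{a - \<tau>..b}. norm (x s) \<le> r' \<and> norm (y s) \<le> r') \<and> energy \<kappa> u a b \<le> \<delta> \<longrightarrow>
      norm (x b - y b) \<le> \<eta>"
    using deviation_from_unforced[OF \<tau> R1 R2 R3 \<kappa> \<gamma>_le_\<kappa> r'(1) T \<eta>] by (elim exE conjE)
  have "norm (x b) \<le> \<beta> (sup_norm \<tau> (history \<tau> x a)) (b - a) + \<eta>"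
    if a: "0 \<le> a" and ab: "a \<le> b" "b \<le> a + T" and u: "u \<in> inputs" and x: "global_solution \<tau> f a u x"
      and x_le: "\<forall>s\<in>{a - \<tau>..b}. norm (x s) \<le> r" and en: "energy \<kappa> u a b \<le> \<delta>" for a b u x
  proof -
    let ?p = "sup_norm \<tau> (history \<tau> x a)"
    have H: "history \<tau> x a \<in> hist_space \<tau>" using global_solution_history[OF x] by simp
    obtain y where y: "global_solution \<tau> f a (\<lambda>_. 0) y" "history \<tau> y a = history \<tau> x a"
      and y_le: "\<forall>t\<ge>a. norm (y t) \<le> \<beta> ?p (t - a)"
      using unforced_solution_exists[OF a H] by blast
    have p: "0 \<le> ?p" "?p \<le> r"
      using sup_norm_nonneg[OF \<tau> H] x_le ab by (auto intro!: sup_norm_history_le[OF \<tau>])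
    have "norm (y s) \<le> r'" if "s \<in> {a - \<tau>..b}" for s
    proof (cases "s < a")
      case True
      then have "y s = x s" using fun_cong[OF y(2), of "s - a"] that by simp
      then show ?thesis using x_le that r'(2) by force
    next
      case False
      then have "norm (y s) \<le> \<beta> ?p (s - a)" using y_le by simp
      also have "\<dots> \<le> \<beta> r 0" using False p by (intro class_KL_le[OF \<beta>]) auto
      finally show ?thesis using r by (simp add: r'_def)
    qed
    then have "norm (x b - y b) \<le> \<eta>"
      using a ab u x y x_le r'(2) en by (intro \<delta>[THEN spec, THEN spec, THEN spec, THEN spec, THEN spec, THEN mp]) force
    moreover have "norm (y b) \<le> \<beta> ?p (b - a)" using y_le ab by simp
    ultimately show ?thesis using norm_triangle_sub[of "x b" "y b"] by linarith
  qed
  then show ?thesis using \<open>\<delta> > 0\<close> by blast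
qed

text \<open>The state at the end of a window of length \<open>T\<close> involves the times after \<open>T - \<tau>\<close>, which by
  monotonicity of \<open>\<beta>\<close> in time all satisfy the estimate at \<open>T - \<tau>\<close>.\<close>
lemma state_near_unforced:
  assumes \<delta>: "\<forall>a b u x. 0 \<le> a \<and> a \<le> b \<and> b \<le> a + T \<and> u \<in> inputs \<and> global_solution \<tau> f a u x \<and>
      (\<forall>s\<in>{a - \<tau>..b}. norm (x s) \<le> r) \<and> energy \<kappa> u a b \<le> \<delta> \<longrightarrow>
      norm (x b) \<le> \<beta> (sup_norm \<tau> (history \<tau> x a)) (b - a) + \<eta>"
    and a: "0 \<le> a" and T: "\<tau> \<le> T" and u: "u \<in> inputs" and x: "global_solution \<tau> f a u x"
    and x_le: "\<forall>s\<in>{a - \<tau>..a + T}. norm (x s) \<le> r" and en: "energy \<kappa> u a (a + T) \<le> \<delta>"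
  shows "sup_norm \<tau> (history \<tau> x (a + T)) \<le> \<beta> (sup_norm \<tau> (history \<tau> x a)) (T - \<tau>) + \<eta>"
proof (rule sup_norm_history_le[OF \<tau>])
  fix s assume s: "s \<in> {a + T - \<tau>..a + T}"
  have "energy \<kappa> u a s \<le> energy \<kappa> u a (a + T)"
    using s T by (intro energy_mono[OF \<kappa> u a]) auto
  then have "norm (x s) \<le> \<beta> (sup_norm \<tau> (history \<tau> x a)) (s - a) + \<eta>"
    using s T a u x x_le en by (intro \<delta>[THEN spec, THEN spec, THEN spec, THEN spec, THEN mp]) force
  also have "\<beta> (sup_norm \<tau> (history \<tau> x a)) (s - a) \<le> \<beta> (sup_norm \<tau> (history \<tau> x a)) (T - \<tau>)"
    using s T sup_norm_nonneg[OF \<tau> global_solution_history[OF x]]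
    by (intro class_KL_le[OF \<beta>]) auto
  finally show "norm (x s) \<le> \<beta> (sup_norm \<tau> (history \<tau> x a)) (T - \<tau>) + \<eta>" by simp
qed

text \<open>The size \<open>q\<close> is chosen so small that an unforced solution from a state of size \<open>q\<close> stays below
  \<open>\<epsilon> / 2\<close>, and the window length \<open>T\<close> so large that its state shrinks below \<open>q / 2\<close>. A deviation of at
  most \<open>q / 2\<close> on each window thus brings the state back to size \<open>q\<close>, so that the argument can be
  repeated on the next window; errors do not accumulate.\<close>
lemma small_data_small_solution:
  assumes \<epsilon>: "0 < \<epsilon>"
  shows "\<exists>\<delta>>0. \<forall>t0 t u x. 0 \<le> t0 \<and> t0 \<le> t \<and> u \<in> inputs \<and> global_solution \<tau> f t0 u x \<and>
    sup_norm \<tau> (history \<tau> x t0) \<le> \<delta> \<and> energy \<kappa> u t0 t \<le> \<delta> \<longrightarrow> norm (x t) \<le> \<epsilon>"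
proof -
  obtain d where "d > 0" and d: "\<And>p. 0 \<le> p \<Longrightarrow> p \<le> d \<Longrightarrow> \<beta> p 0 \<le> \<epsilon> / 2"
    using class_K_small[OF class_KL_K[OF \<beta>], of 0 "\<epsilon> / 2"] \<epsilon> by auto
  define q where "q = min d (min 1 \<epsilon>)"
  have q: "0 < q" "q \<le> d" "q \<le> 1" "q \<le> \<epsilon>" using \<open>d > 0\<close> \<epsilon> by (auto simp: q_def)
  obtain T0 where T0: "0 \<le> T0" "\<beta> q T0 \<le> q / 2"
    using class_KL_eventually_small[OF \<beta>, of q "q / 2"] q by auto
  define T where "T = T0 + \<tau> + 1"
  have T: "0 < T" "\<tau> \<le> T" "T0 \<le> T - \<tau>" using T0 \<tau> by (auto simp: T_def)
  \<comment> \<open>The initial size and the energy are at most 1, so UBEBS keeps the solution in the ball of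
    radius \<open>r\<close>, as the window estimate requires. The offset \<open>c\<close> enters only here, so it affects the
    choice of \<open>\<delta>\<close> but not the final bound.\<close>
  define r where "r = 1 + (\<alpha> 1 + \<rho> 1 + c)"
  have r: "0 < r" "1 \<le> r" "\<alpha> 1 + \<rho> 1 + c \<le> r"
    using class_K_nonneg[OF \<alpha>, of 1] class_K_nonneg[OF \<rho>, of 1] c by (auto simp: r_def)
  obtain e where "e > 0" and e: "\<forall>a b u x. 0 \<le> a \<and> a \<le> b \<and> b \<le> a + T \<and> u \<in> inputs \<and>
      global_solution \<tau> f a u x \<and> (\<forall>s\<in>{a - \<tau>..b}. norm (x s) \<le> r) \<and> energy \<kappa> u a b \<le> e \<longrightarrow>
      norm (x b) \<le> \<beta> (sup_norm \<tau> (history \<tau> x a)) (b - a) + q / 2"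
    using near_unforced[OF r(1) T(1), of "q / 2"] q(1) by auto
  have "norm (x t) \<le> \<epsilon>"
    if t0: "0 \<le> t0" and t: "t0 \<le> t" and u: "u \<in> inputs" and x: "global_solution \<tau> f t0 u x"
      and init: "sup_norm \<tau> (history \<tau> x t0) \<le> min q e" and en: "energy \<kappa> u t0 t \<le> min q e" for t0 t u x
  proof -
    have H: "0 \<le> sup_norm \<tau> (history \<tau> x s)" if "t0 \<le> s" for s
      using sup_norm_nonneg[OF \<tau> global_solution_history[OF x that]] .
    have x_le: "norm (x s) \<le> r" if s: "s \<in> {t0 - \<tau>..t}" for s
    proof (cases "s < t0")
      case True
      have "norm (x s) \<le> sup_norm \<tau> (history \<tau> x t0)"
        using True s by (intro norm_le_sup_norm_history global_solution_continuous_on[OF x]) auto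
      then show ?thesis using init q r by linarith
    next
      case False
      have "energy \<kappa> u t0 s \<le> energy \<kappa> u t0 t"
        using False s by (intro energy_mono[OF \<kappa> u t0]) auto
      then have "\<rho> (energy \<kappa> u t0 s) \<le> \<rho> 1"
        using en q by (intro class_K_mono[OF \<rho> energy_nonneg]) auto
      moreover have "\<alpha> (sup_norm \<tau> (history \<tau> x t0)) \<le> \<alpha> 1"
        using init q by (intro class_K_mono[OF \<alpha> H]) auto
      ultimately show ?thesis
        using energy_bounded[OF t0 u x, of s] False r(3) by linarith
    qed
    have en_le: "energy \<kappa> u a b \<le> e" if "t0 \<le> a" "a \<le> b" "b \<le> t" for a b
      using energy_mono[OF \<kappa> u t0 that] en by simp
    have state: "sup_norm \<tau> (history \<tau> x (t0 + real k * T)) \<le> q" if "t0 + real k * T \<le> t" for k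
      using that
    proof (induction k)
      case 0
      then show ?case using init by simp
    next
      case (Suc k)
      let ?a = "t0 + real k * T"
      have eq: "t0 + real (Suc k) * T = ?a + T" by (simp add: algebra_simps)
      have a: "t0 \<le> ?a" "?a \<le> t" "?a + T \<le> t" using T Suc.prems unfolding eq by auto
      have "t0 - \<tau> \<le> s \<and> s \<le> t" if "s \<in> {?a - \<tau>..?a + T}" for s
        using that a unfolding atLeastAtMost_iff by linarith
      then have window: "\<forall>s\<in>{?a - \<tau>..?a + T}. norm (x s) \<le> r"
        using x_le by simp
      have "0 \<le> ?a" "?a \<le> ?a + T" using t0 a(1) T by linarith+
      then have "sup_norm \<tau> (history \<tau> x (?a + T)) \<le> \<beta> (sup_norm \<tau> (history \<tau> x ?a)) (T - \<tau>) + q / 2"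
        by (intro state_near_unforced[OF e _ T(2) u global_solution_restart[OF x a(1)] window en_le] a)
      also have "\<beta> (sup_norm \<tau> (history \<tau> x ?a)) (T - \<tau>) \<le> \<beta> q T0"
        using Suc.IH a T T0 by (intro class_KL_le[OF \<beta>] H) auto
      also have "\<beta> q T0 \<le> q / 2" by (rule T0)
      finally show ?case unfolding eq by simp
    qed
    define k where "k = nat \<lfloor>(t - t0) / T\<rfloor>"
    have "0 \<le> (t - t0) / T" using t T by simp
    then have "real k \<le> (t - t0) / T" "(t - t0) / T \<le> real k + 1"
      unfolding k_def by linarith+
    then have k: "t0 + real k * T \<le> t" "t \<le> t0 + real k * T + T"
      using T by (simp_all add: field_simps)
    let ?a = "t0 + real k * T"
    have a: "t0 \<le> ?a" using T by simp
    have "norm (x t) \<le> \<beta> (sup_norm \<tau> (history \<tau> x ?a)) (t - ?a) + q / 2"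
    proof (intro e[THEN spec, THEN spec, THEN spec, THEN spec, THEN mp] conjI ballI k u)
      show "0 \<le> ?a" using t0 a by linarith
      show "global_solution \<tau> f ?a u x" using global_solution_restart[OF x a] .
      show "energy \<kappa> u ?a t \<le> e" using en_le[OF a k(1)] by simp
      show "norm (x s) \<le> r" if "s \<in> {?a - \<tau>..t}" for s
        using that a unfolding atLeastAtMost_iff by (intro x_le) auto
    qed (rule u)
    also have "\<beta> (sup_norm \<tau> (history \<tau> x ?a)) (t - ?a) \<le> \<beta> q 0"
      using state[OF k(1)] k(1) by (intro class_KL_le[OF \<beta>] H a) auto
    also have "\<beta> q 0 \<le> \<epsilon> / 2" using d q by simp
    finally show ?thesis using q by linarith
  qed
  then show ?thesis using q \<open>e > 0\<close> by (intro exI[of _ "min q e"]) auto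
qed

text \<open>UBEBS bounds the solution for arbitrary data, and small data give small solutions, so the
  supremum over all data of size \<open>r\<close> is finite and tends to \<open>0\<close> with \<open>r\<close>.\<close>
lemma energy_bounded_without_offset:
  "\<exists>a. class_Kinf a \<and> (\<forall>t0 t u x. 0 \<le> t0 \<and> t0 \<le> t \<and> u \<in> inputs \<and> global_solution \<tau> f t0 u x \<longrightarrow>
    norm (x t) \<le> a (sup_norm \<tau> (history \<tau> x t0)) + a (energy \<kappa> u t0 t))"
proof -
  define R where "R p e v \<longleftrightarrow> (\<exists>t0 t u x. 0 \<le> t0 \<and> t0 \<le> t \<and> u \<in> inputs \<and> global_solution \<tau> f t0 u x \<and>
    p = sup_norm \<tau> (history \<tau> x t0) \<and> e = energy \<kappa> u t0 t \<and> v = norm (x t))" for p e v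
  have "\<exists>a. class_Kinf a \<and> (\<forall>p e v. R p e v \<longrightarrow> v \<le> a p + a e)"
  proof (rule class_Kinf_sum_bound)
    show nonneg: "0 \<le> p \<and> 0 \<le> e" if "R p e v" for p e v
      using that sup_norm_nonneg[OF \<tau> global_solution_history] energy_nonneg unfolding R_def by blast
    show "\<exists>B. \<forall>p e v. R p e v \<and> p \<le> r \<and> e \<le> r \<longrightarrow> v \<le> B" for r
    proof (intro exI[of _ "\<alpha> r + \<rho> r + c"] allI impI)
      fix p e v assume *: "R p e v \<and> p \<le> r \<and> e \<le> r"
      then have "v \<le> \<alpha> p + \<rho> e + c" using energy_bounded unfolding R_def by blast
      then show "v \<le> \<alpha> r + \<rho> r + c"
        using class_K_mono[OF \<alpha>, of p r] class_K_mono[OF \<rho>, of e r] nonneg * by fastforce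
    qed
    show "\<exists>\<delta>>0. \<forall>p e v. R p e v \<and> p \<le> \<delta> \<and> e \<le> \<delta> \<longrightarrow> v \<le> \<epsilon>" if "0 < \<epsilon>" for \<epsilon>
    proof -
      obtain \<delta> where "\<delta> > 0" and \<delta>: "\<forall>t0 t u x. 0 \<le> t0 \<and> t0 \<le> t \<and> u \<in> inputs \<and> global_solution \<tau> f t0 u x \<and>
          sup_norm \<tau> (history \<tau> x t0) \<le> \<delta> \<and> energy \<kappa> u t0 t \<le> \<delta> \<longrightarrow> norm (x t) \<le> \<epsilon>"
        using small_data_small_solution[OF \<open>0 < \<epsilon>\<close>] by (elim exE conjE)
      then show ?thesis unfolding R_def by blast
    qed
  qed
  then obtain a where "class_Kinf a" "\<forall>p e v. R p e v \<longrightarrow> v \<le> a p + a e" by blast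
  then show ?thesis unfolding R_def by blast
qed

text \<open>Let \<open>n > r / \<delta>\<close>, where \<open>\<delta>\<close> is the energy below which a window of length \<open>S\<close> brings every state of
  size \<open>R\<close> down to size \<open>d\<close>. Since energies of consecutive windows add up, \<open>n\<close> windows with more than
  \<open>\<delta>\<close> each would exceed the total \<open>r\<close>. So some window has energy at most \<open>\<delta>\<close>. The energy spent after
  this window may be large, but restarting the estimate \<open>a_bound\<close> at its end charges it to
  \<open>a (energy \<kappa> u t0 t)\<close>, whereas the state there contributes at most \<open>a d \<le> \<epsilon>\<close>.\<close>
lemma attractive:
  assumes a: "class_K a" and a_bound: "\<And>t0 t u x. 0 \<le> t0 \<Longrightarrow> t0 \<le> t \<Longrightarrow> u \<in> inputs \<Longrightarrow>
      global_solution \<tau> f t0 u x \<Longrightarrow>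
      norm (x t) \<le> a (sup_norm \<tau> (history \<tau> x t0)) + a (energy \<kappa> u t0 t)"
    and r: "0 < r" and \<epsilon>: "0 < \<epsilon>"
  shows "\<exists>T\<ge>0. \<forall>t0 t u x. 0 \<le> t0 \<and> t0 + T \<le> t \<and> u \<in> inputs \<and> global_solution \<tau> f t0 u x \<and>
    sup_norm \<tau> (history \<tau> x t0) \<le> r \<and> energy \<kappa> u t0 t \<le> r \<longrightarrow> norm (x t) \<le> \<epsilon> + a (energy \<kappa> u t0 t)"
proof -
  define R where "R = r + (a r + a r)"
  have R: "0 < R" "r \<le> R" "a r + a r \<le> R"
    using class_K_nonneg[OF a, of r] r by (auto simp: R_def)
  obtain d where "d > 0" and d: "\<And>p. 0 \<le> p \<Longrightarrow> p \<le> d \<Longrightarrow> a p \<le> \<epsilon>"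
    using class_K_small[OF a \<epsilon>] by blast
  obtain T0 where T0: "0 \<le> T0" "\<beta> R T0 \<le> d / 2"
    using class_KL_eventually_small[OF \<beta>, of R "d / 2"] R \<open>d > 0\<close> by auto
  define S where "S = T0 + \<tau> + 1"
  have S: "0 < S" "\<tau> \<le> S" "T0 \<le> S - \<tau>" using T0 \<tau> by (auto simp: S_def)
  obtain \<delta> where "\<delta> > 0" and \<delta>: "\<forall>a b u x. 0 \<le> a \<and> a \<le> b \<and> b \<le> a + S \<and> u \<in> inputs \<and>
      global_solution \<tau> f a u x \<and> (\<forall>s\<in>{a - \<tau>..b}. norm (x s) \<le> R) \<and> energy \<kappa> u a b \<le> \<delta> \<longrightarrow>
      norm (x b) \<le> \<beta> (sup_norm \<tau> (history \<tau> x a)) (b - a) + d / 2"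
    using near_unforced[OF R(1) S(1), of "d / 2"] \<open>d > 0\<close> by auto
  obtain n :: nat where n: "r < real n * \<delta>"
    using reals_Archimedean3[OF \<open>\<delta> > 0\<close>] by blast
  have "norm (x t) \<le> \<epsilon> + a (energy \<kappa> u t0 t)"
    if t0: "0 \<le> t0" and t: "t0 + real n * S \<le> t" and u: "u \<in> inputs" and x: "global_solution \<tau> f t0 u x"
      and init: "sup_norm \<tau> (history \<tau> x t0) \<le> r" and en: "energy \<kappa> u t0 t \<le> r" for t0 t u x
  proof -
    define s where "s k = t0 + real k * S" for k
    have s_Suc: "s (Suc k) = s k + S" for k by (simp add: s_def algebra_simps)
    have s_ge: "t0 \<le> s k" for k using S by (simp add: s_def)
    have s_le: "s k \<le> t" if "k \<le> n" for k
    proof -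
      have "real k * S \<le> real n * S" using that S by (intro mult_right_mono) auto
      then show ?thesis using t by (simp add: s_def)
    qed
    have H: "0 \<le> sup_norm \<tau> (history \<tau> x s)" if "t0 \<le> s" for s
      using sup_norm_nonneg[OF \<tau> global_solution_history[OF x that]] .
    have x_le: "norm (x q) \<le> R" if q: "q \<in> {t0 - \<tau>..t}" for q
    proof (cases "q < t0")
      case True
      have "norm (x q) \<le> sup_norm \<tau> (history \<tau> x t0)"
        using True q by (intro norm_le_sup_norm_history global_solution_continuous_on[OF x]) auto
      then show ?thesis using init R by linarith
    next
      case False
      have "energy \<kappa> u t0 q \<le> energy \<kappa> u t0 t"
        using False q by (intro energy_mono[OF \<kappa> u t0]) auto
      then have "a (energy \<kappa> u t0 q) \<le> a r"
        using en by (intro class_K_mono[OF a energy_nonneg]) auto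
      moreover have "a (sup_norm \<tau> (history \<tau> x t0)) \<le> a r"
        using init by (intro class_K_mono[OF a H]) auto
      ultimately show ?thesis
        using a_bound[OF t0 _ u x, of q] False R(3) by linarith
    qed
    have "\<exists>k<n. energy \<kappa> u (s k) (s (Suc k)) \<le> \<delta>"
    proof (rule ccontr)
      assume "\<not> ?thesis"
      then have big: "\<delta> < energy \<kappa> u (s k) (s (Suc k))" if "k < n" for k using that by force
      have "real k * \<delta> \<le> energy \<kappa> u t0 (s k)" if "k \<le> n" for k
        using that
      proof (induction k)
        case 0
        then show ?case by (simp add: energy_nonneg)
      next
        case (Suc k)
        have "energy \<kappa> u t0 (s (Suc k)) = energy \<kappa> u t0 (s k) + energy \<kappa> u (s k) (s (Suc k))"
          using S s_ge by (intro energy_combine[OF \<kappa> u t0]) (auto simp: s_Suc)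
        then show ?case using Suc big[of k] by (simp add: algebra_simps)
      qed
      then have "real n * \<delta> \<le> energy \<kappa> u t0 (s n)" by simp
      also have "\<dots> \<le> energy \<kappa> u t0 t"
        using s_ge s_le by (intro energy_mono[OF \<kappa> u t0]) auto
      finally show False using n en by simp
    qed
    then obtain k where k: "k < n" and en_k: "energy \<kappa> u (s k) (s k + S) \<le> \<delta>"
      unfolding s_Suc by blast
    let ?b = "s k + S"
    have b: "t0 \<le> ?b" "?b \<le> t" using s_ge[of "Suc k"] s_le[of "Suc k"] k unfolding s_Suc by auto
    have "sup_norm \<tau> (history \<tau> x ?b) \<le> \<beta> (sup_norm \<tau> (history \<tau> x (s k))) (S - \<tau>) + d / 2"
      using s_ge[of k] t0 b x_le
      by (intro state_near_unforced[OF \<delta> _ S(2) u global_solution_restart[OF x s_ge] _ en_k]) auto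
    also have "\<beta> (sup_norm \<tau> (history \<tau> x (s k))) (S - \<tau>) \<le> \<beta> R T0"
    proof (rule class_KL_le[OF \<beta> H[OF s_ge] _ T0(1) S(3)])
      show "sup_norm \<tau> (history \<tau> x (s k)) \<le> R"
        using s_ge[of k] s_le[of k] k x_le by (intro sup_norm_history_le[OF \<tau>]) auto
    qed
    also have "\<beta> R T0 \<le> d / 2" by (rule T0)
    finally have "a (sup_norm \<tau> (history \<tau> x ?b)) \<le> \<epsilon>" using H[OF b(1)] by (intro d) auto
    moreover have "a (energy \<kappa> u ?b t) \<le> a (energy \<kappa> u t0 t)"
      using b by (intro class_K_mono[OF a energy_nonneg] energy_mono[OF \<kappa> u t0]) auto
    moreover have "norm (x t) \<le> a (sup_norm \<tau> (history \<tau> x ?b)) + a (energy \<kappa> u ?b t)"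
      using b t0 by (intro a_bound u global_solution_restart[OF x]) auto
    ultimately show ?thesis by linarith
  qed
  then show ?thesis using S by (intro exI[of _ "real n * S"]) auto
qed

lemma iISS_estimate:
  "\<exists>\<beta>' \<rho>'. class_KL \<beta>' \<and> class_Kinf \<rho>' \<and>
    (\<forall>t0 t u x. 0 \<le> t0 \<and> t0 \<le> t \<and> u \<in> inputs \<and> global_solution \<tau> f t0 u x \<longrightarrow>
      norm (x t) \<le> \<beta>' (sup_norm \<tau> (history \<tau> x t0)) (t - t0) + \<rho>' (energy \<kappa> u t0 t))"
proof -
  obtain a where a: "class_Kinf a" and a_bound: "\<forall>t0 t u x. 0 \<le> t0 \<and> t0 \<le> t \<and> u \<in> inputs \<and>
      global_solution \<tau> f t0 u x \<longrightarrow> norm (x t) \<le> a (sup_norm \<tau> (history \<tau> x t0)) + a (energy \<kappa> u t0 t)"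
    using energy_bounded_without_offset by (elim exE conjE)
  have aK: "class_K a" using a by (simp add: class_Kinf_def)
  define R where "R p e s v \<longleftrightarrow> (\<exists>t0 t u x. 0 \<le> t0 \<and> t0 \<le> t \<and> u \<in> inputs \<and> global_solution \<tau> f t0 u x \<and>
    p = sup_norm \<tau> (history \<tau> x t0) \<and> e = energy \<kappa> u t0 t \<and> s = t - t0 \<and> v = norm (x t))" for p e s v
  have "\<exists>\<beta>' \<rho>'. class_KL \<beta>' \<and> class_Kinf \<rho>' \<and> (\<forall>p e s v. R p e s v \<longrightarrow> v \<le> \<beta>' p s + \<rho>' e)"
  proof (rule class_KL_sum_bound[OF _ a])
    show "0 \<le> p \<and> 0 \<le> e \<and> 0 \<le> s" if "R p e s v" for p e s v
      using that sup_norm_nonneg[OF \<tau> global_solution_history] energy_nonneg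
      unfolding R_def by (metis diff_ge_0_iff_ge order_refl)
    show "v \<le> a p + a e" if "R p e s v" for p e s v
      using that a_bound unfolding R_def by blast
    fix r \<epsilon> :: real assume r\<epsilon>: "0 < r" "0 < \<epsilon>"
    obtain T where "0 \<le> T" and T: "\<forall>t0 t u x. 0 \<le> t0 \<and> t0 + T \<le> t \<and> u \<in> inputs \<and> global_solution \<tau> f t0 u x \<and>
        sup_norm \<tau> (history \<tau> x t0) \<le> r \<and> energy \<kappa> u t0 t \<le> r \<longrightarrow> norm (x t) \<le> \<epsilon> + a (energy \<kappa> u t0 t)"
      using attractive[OF aK _ r\<epsilon>] a_bound by blast
    have "v \<le> \<epsilon> + a e" if R: "R p e s v" "p \<le> r" "e \<le> r" "T \<le> s" for p e s v
    proof -
      obtain t0 t u x where "0 \<le> t0" "u \<in> inputs" "global_solution \<tau> f t0 u x" "s = t - t0"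
        "p = sup_norm \<tau> (history \<tau> x t0)" "e = energy \<kappa> u t0 t" "v = norm (x t)"
        using R(1) unfolding R_def by blast
      then show ?thesis using T R(2-4) by (simp add: algebra_simps)
    qed
    then show "\<exists>T\<ge>0. \<forall>p e t v. R p e t v \<and> p \<le> r \<and> e \<le> r \<and> T \<le> t \<longrightarrow> v \<le> \<epsilon> + a e"
      using \<open>0 \<le> T\<close> by blast
  qed
  then obtain \<beta>' \<rho>' where "class_KL \<beta>'" "class_Kinf \<rho>'" "\<forall>p e s v. R p e s v \<longrightarrow> v \<le> \<beta>' p s + \<rho>' e"
    by (elim exE conjE)
  then show ?thesis unfolding R_def by blast
qed

end


section \<open>The equivalence\<close>

lemma iISS_imp_zero_GUAS:
  fixes f :: "('n::finite, 'm::finite) rhs"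
  assumes "iISS \<tau> f \<kappa>"
  shows "zero_GUAS \<tau> f"
proof -
  obtain \<beta> \<rho> where "class_Kinf \<kappa>" and \<beta>: "class_KL \<beta>" and "class_Kinf \<rho>"
    and bound: "\<forall>t0\<ge>0. \<forall>\<psi>\<in>hist_space \<tau>. \<forall>u\<in>inputs. \<forall>T x. is_max_solution \<tau> f t0 \<psi> u T x \<longrightarrow>
      T = \<infinity> \<and> (\<forall>t\<ge>t0. norm (x t) \<le> \<beta> (sup_norm \<tau> \<psi>) (t - t0) +
        \<rho> (enn2real (input_energy \<kappa> (truncate_input u t0 t))))"
    using assms unfolding iISS_def by blast
  then have \<kappa>: "class_K \<kappa>" and \<rho>: "class_K \<rho>" by (simp_all add: class_Kinf_def)
  have "\<rho> (energy \<kappa> (\<lambda>_. 0 :: real ^ 'm) t0 t) = 0" for t0 t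
    using \<rho> by (simp add: energy_zero[OF \<kappa>] class_K_def)
  then have "\<forall>t0\<ge>0. \<forall>\<psi>\<in>hist_space \<tau>. \<forall>T x. is_max_solution \<tau> f t0 \<psi> (\<lambda>_. 0) T x \<longrightarrow>
      T = \<infinity> \<and> (\<forall>t\<ge>t0. norm (x t) \<le> \<beta> (sup_norm \<tau> \<psi>) (t - t0))"
    using bound[folded energy_def, rule_format, OF _ _ zero_in_inputs] by fastforce
  then show ?thesis using \<beta> unfolding zero_GUAS_def by blast
qed

text \<open>The function \<open>r \<mapsto> \<beta> r 0\<close> need not be unbounded; adding \<open>r\<close> puts it into class \<open>K\<^sub>\<infinity>\<close>.\<close>
lemma iISS_imp_UBEBS:
  fixes f :: "('n::finite, 'm::finite) rhs"
  assumes \<tau>: "0 \<le> \<tau>" and iISS: "iISS \<tau> f \<kappa>"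
  shows "UBEBS \<tau> f \<kappa>"
proof -
  obtain \<beta> \<rho> where \<kappa>: "class_Kinf \<kappa>" and \<beta>: "class_KL \<beta>" and \<rho>: "class_Kinf \<rho>"
    and bound: "\<forall>t0\<ge>0. \<forall>\<psi>\<in>hist_space \<tau>. \<forall>u\<in>inputs. \<forall>T x. is_max_solution \<tau> f t0 \<psi> u T x \<longrightarrow>
      T = \<infinity> \<and> (\<forall>t\<ge>t0. norm (x t) \<le> \<beta> (sup_norm \<tau> \<psi>) (t - t0) +
        \<rho> (enn2real (input_energy \<kappa> (truncate_input u t0 t))))"
    using iISS unfolding iISS_def by blast
  define \<alpha> where "\<alpha> r = \<beta> r 0 + r" for r
  have \<beta>0: "class_K (\<lambda>r. \<beta> r 0)" using class_KL_K[OF \<beta>] by simp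
  have \<alpha>: "class_Kinf \<alpha>"
    unfolding \<alpha>_def using class_Kinf_id class_K_nonneg[OF \<beta>0]
    by (intro class_KinfI[OF class_K_add[OF \<beta>0] class_Kinf_id]) (auto simp: class_Kinf_def)
  have "\<beta> (sup_norm \<tau> \<psi>) (t - t0) \<le> \<alpha> (sup_norm \<tau> \<psi>)" if "\<psi> \<in> hist_space \<tau>" "t0 \<le> t" for \<psi> :: "real \<Rightarrow> real ^ 'n" and t t0
    using class_KL_le[OF \<beta> _ order_refl order_refl, of "sup_norm \<tau> \<psi>" "t - t0"] sup_norm_nonneg[OF \<tau> that(1)] that(2)
    by (simp add: \<alpha>_def)
  then have "\<forall>t0\<ge>0. \<forall>\<psi>\<in>hist_space \<tau>. \<forall>u\<in>inputs. \<forall>T x. is_max_solution \<tau> f t0 \<psi> u T x \<longrightarrow>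
      T = \<infinity> \<and> (\<forall>t\<ge>t0. norm (x t) \<le> \<alpha> (sup_norm \<tau> \<psi>) +
        \<rho> (enn2real (input_energy \<kappa> (truncate_input u t0 t))) + 0)"
    using bound by fastforce
  then show ?thesis
    using \<kappa> \<alpha> \<rho> unfolding UBEBS_def by blast
qed

lemma zero_GUAS_UBEBS_imp_iISS:
  assumes system: "time_delay_system \<tau> f"
    and R1: "cond_R1 \<tau> f \<gamma>" and R2: "cond_R2 \<tau> f" and R3: "cond_R3 \<tau> f"
    and GUAS: "zero_GUAS \<tau> f" and UBEBS: "UBEBS \<tau> f \<alpha>"
  shows "iISS \<tau> f (\<lambda>r. max (\<alpha> r) (\<gamma> r))"
proof -
  define \<kappa> where "\<kappa> r = max (\<alpha> r) (\<gamma> r)" for r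
  obtain \<beta> where \<beta>: "class_KL \<beta>" and unforced: "\<forall>t0\<ge>0. \<forall>\<psi>\<in>hist_space \<tau>. \<forall>T x.
      is_max_solution \<tau> f t0 \<psi> (\<lambda>_. 0) T x \<longrightarrow>
      T = \<infinity> \<and> (\<forall>t\<ge>t0. norm (x t) \<le> \<beta> (sup_norm \<tau> \<psi>) (t - t0))"
    using GUAS unfolding zero_GUAS_def by blast
  obtain a \<rho> c where c: "0 \<le> c" and a: "class_Kinf a" and \<rho>: "class_Kinf \<rho>" and \<alpha>: "class_Kinf \<alpha>"
    and bound: "\<forall>t0\<ge>0. \<forall>\<psi>\<in>hist_space \<tau>. \<forall>u\<in>inputs. \<forall>T x. is_max_solution \<tau> f t0 \<psi> u T x \<longrightarrow>
      T = \<infinity> \<and> (\<forall>t\<ge>t0. norm (x t) \<le> a (sup_norm \<tau> \<psi>) + \<rho> (energy \<alpha> u t0 t) + c)"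
    using UBEBS unfolding UBEBS_def energy_def by blast
  have \<alpha>K: "class_K \<alpha>" and \<gamma>K: "class_K \<gamma>" and aK: "class_K a" and \<rho>K: "class_K \<rho>"
    using \<alpha> a \<rho> R1 by (auto simp: class_Kinf_def cond_R1_def)
  have \<kappa>K: "class_K \<kappa>" unfolding \<kappa>_def using \<alpha>K \<gamma>K by (rule class_K_max)
  have \<kappa>_Kinf: "class_Kinf \<kappa>" by (rule class_KinfI[OF \<kappa>K \<alpha>]) (simp add: \<kappa>_def)
  interpret stable_delay_system \<tau> f \<gamma> \<kappa> a \<rho> \<beta> c
  proof
    show "\<forall>s\<ge>0. \<gamma> s \<le> \<kappa> s" by (simp add: \<kappa>_def)
    show "T = \<infinity> \<and> (\<forall>t\<ge>t0. norm (x t) \<le> \<beta> (sup_norm \<tau> \<psi>) (t - t0))"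
      if "0 \<le> t0" "\<psi> \<in> hist_space \<tau>" "is_max_solution \<tau> f t0 \<psi> (\<lambda>_. 0) T x" for t0 \<psi> T x
      using unforced that by blast
    show "norm (x t) \<le> a (sup_norm \<tau> (history \<tau> x t0)) + \<rho> (energy \<kappa> u t0 t) + c"
      if "0 \<le> t0" "u \<in> inputs" "global_solution \<tau> f t0 u x" "t0 \<le> t" for t0 u x t
    proof -
      have "norm (x t) \<le> a (sup_norm \<tau> (history \<tau> x t0)) + \<rho> (energy \<alpha> u t0 t) + c"
        using bound that global_solution_is_max_solution[OF that(3)] global_solution_history[OF that(3)]
        by blast
      moreover have "\<rho> (energy \<alpha> u t0 t) \<le> \<rho> (energy \<kappa> u t0 t)"
        by (intro class_K_mono[OF \<rho>K energy_nonneg] energy_mono_gain[OF \<alpha>K \<kappa>K]) (use that in \<open>auto simp: \<kappa>_def\<close>)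
      ultimately show ?thesis by linarith
    qed
  qed (fact system R1 R2 R3 \<kappa>K \<beta> aK \<rho>K c)+
  obtain \<beta>' \<rho>' where \<beta>': "class_KL \<beta>'" and \<rho>': "class_Kinf \<rho>'"
    and estimate: "\<forall>t0 t u x. 0 \<le> t0 \<and> t0 \<le> t \<and> u \<in> inputs \<and> global_solution \<tau> f t0 u x \<longrightarrow>
      norm (x t) \<le> \<beta>' (sup_norm \<tau> (history \<tau> x t0)) (t - t0) + \<rho>' (energy \<kappa> u t0 t)"
    using iISS_estimate by (elim exE conjE)
  have "\<forall>t0\<ge>0. \<forall>\<psi>\<in>hist_space \<tau>. \<forall>u\<in>inputs. \<forall>T x. is_max_solution \<tau> f t0 \<psi> u T x \<longrightarrow>
      T = \<infinity> \<and> (\<forall>t\<ge>t0. norm (x t) \<le> \<beta>' (sup_norm \<tau> \<psi>) (t - t0) +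
        \<rho>' (enn2real (input_energy \<kappa> (truncate_input u t0 t))))"
  proof (intro allI ballI impI)
    fix t0 :: real and \<psi> u T x
    assume that: "0 \<le> t0" "\<psi> \<in> hist_space \<tau>" "u \<in> inputs" "is_max_solution \<tau> f t0 \<psi> u T x"
    have T: "T = \<infinity>" using bound that by blast
    have "global_solution \<tau> f t0 u x" "history \<tau> x t0 = \<psi>"
      using is_max_solution_global_solution that(4) unfolding T by blast+
    then show "T = \<infinity> \<and> (\<forall>t\<ge>t0. norm (x t) \<le> \<beta>' (sup_norm \<tau> \<psi>) (t - t0) +
        \<rho>' (enn2real (input_energy \<kappa> (truncate_input u t0 t))))"
      using T estimate that(1,3) unfolding energy_def by blast
  qed
  then have "iISS \<tau> f \<kappa>"
    unfolding iISS_def using \<kappa>_Kinf \<beta>' \<rho>' by (intro conjI exI)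
  then show ?thesis unfolding \<kappa>_def .
qed

theorem theorem4p1:
  fixes \<tau> :: real
    and f :: "real \<Rightarrow> (real \<Rightarrow> real ^ 'n) \<Rightarrow> real ^ 'm \<Rightarrow> real ^ 'n"
    and \<gamma> :: "real \<Rightarrow> real"
  assumes "time_delay_system \<tau> f"
    and "cond_R1 \<tau> f \<gamma>"
    and "cond_R2 \<tau> f"
    and "cond_R3 \<tau> f"
  shows "(\<forall>\<kappa>. iISS \<tau> f \<kappa> \<longrightarrow> zero_GUAS \<tau> f \<and> UBEBS \<tau> f \<kappa>) \<and>
         (\<forall>\<alpha>. zero_GUAS \<tau> f \<and> UBEBS \<tau> f \<alpha> \<longrightarrow> iISS \<tau> f (\<lambda>r. max (\<alpha> r) (\<gamma> r)))"
proof -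
  have "0 \<le> \<tau>" using assms(1) by (simp add: time_delay_system_def)
  then show ?thesis
    using iISS_imp_zero_GUAS iISS_imp_UBEBS zero_GUAS_UBEBS_imp_iISS[OF assms] by blast
qed

end
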